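(* Let $w\in S_n$ be almost defined by inclusions, let $v$ be the defined by inclusions permutation associated to $w$, and let $(p,q)\in E''(w)$. Then $$I_{(p,q,r_w(p,q))}\subseteq I_v+\langle f_{(p,q)}\rangle .$$
   Context: Write $[a,b]=\{x\in\mathbb{Z}: a\le x\le b\}$. Positions $(p,q)$ are matrix positions (row $p$ from the top, column $q$ from the left). For $w\in S_n$ set $r_w(p,q)=\#\{k\le q : w(k)\ge p\}$, $D(w)=\{(p,q)\in[1,n]^2 : w(q)<p,\ w^{-1}(p)>q\}$ and $E(w)=\{(p,q)\in D(w): (p,q+1)\notin D(w),\ (p-1,q)\notin D(w)\}$. Call $w$ defined by inclusions if $q-r_w(p,q)=\min\{p-1,q\}$ for every $(p,q)\in E(w)$. Conditions on $(p,q)\in E(w)$: A: there is no $k$ with $k\le q$ and $w(k)\ge p$. B: there is no $k$ with $k>q$ and $w(k)<p$. W: for all $p'<p$, $(p',q)\notin E(w)$; and either $(p,q-1)\notin D(w)$ or there exists $p'<p$ with $(p',q-1)\in E(w)$ satisfying Condition B and $r_w(p',q-1)=r_w(p,q)$. X: there is a unique $p'<p$ with $(p',q)\in E(w)$; $(p',q)$ satisfies Condition B and $r_w(p',q)=r_w(p,q)+1$; and, if $q'$ is the smallest integer with $(p',b)\in D(w)$ for all $b\in[q',q]$, then $(p,q'-1)\in D(w)$. Y: for all $q'>q$, $(p,q')\notin E(w)$; and either $(p+1,q)\notin D(w)$ or there exists $q'>q$ with $(p+1,q')\in E(w)$ satisfying Condition B and $r_w(p+1,q')=r_w(p,q)$.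 Z: there is a unique $q'>q$ with $(p,q')\in E(w)$; $(p,q')$ satisfies Condition B and $r_w(p,q')=r_w(p,q)+1$; and, if $p'$ is the greatest integer with $(a,q')\in D(w)$ for all $a\in[p,p']$, then $(p'+1,q)\in D(w)$. The permutation $w$ is almost defined by inclusions if every $(p,q)\in E(w)$ satisfies A or B, or satisfies both (W or X) and (Y or Z). Let $E''(w)$ be the set of $(p,q)\in E(w)$ satisfying neither A nor B. For $w$ almost defined by inclusions there is a unique permutation $v\in S_n$ with $E(v)=E(w)\setminus E''(w)$ and $r_v(p,q)=r_w(p,q)$ for all $(p,q)\in E(v)$; it is defined by inclusions, and is called the defined by inclusions permutation associated to $w$. Let $S=\mathbb{C}[z_{p,q}]_{1\le q<p\le n}$, and let $M$ be the $n\times n$ matrix with entry $z_{p,q}$ at $(p,q)$ for $p>q$, $1$'s on the diagonal, and $0$'s above it. For $A,B\subseteq[1,n]$ with $\#A=\#B$, $d_{A,B}$ is the minor of $M$ with rows $A$ and columns $B$. $I_{(p,q,r)}\subseteq S$ is the ideal generated by all $d_{A,B}$ with $A\subseteq[p,n]$, $B\subseteq[1,q]$, $\#A=\#B=r+1$, and $I_v=\sum_{(p,q)\in E(v)}I_{(p,q,r_v(p,q))}$. For $(p,q)\in E''(w)$, $f_{(p,q)}=d_{A'(p,q),B'(p,q)}$ with $A'(p,q)=[p,p+r_w(p,q)]$ and $B'(p,q)=[q-r_w(p,q),q]$. *)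

theory Defs
  imports
    "HOL-Library.Poly_Mapping"
    "HOL-Combinatorics.Permutations"
    "HOL-Algebra.Ideal"
    "Jordan_Normal_Form.Determinant"
    "Jordan_Normal_Form.DL_Submatrix"
begin

text \<open>
  Elements of \<open>S\<^sub>n\<close> are functions \<open>w :: nat \<Rightarrow> nat\<close> with \<open>w permutes {1..n}\<close>. Matrix positions
  are pairs of 1-based naturals. As \<open>diagram n w\<close> lies in \<open>{1..n} \<times> {1..n}\<close>, positions with a
  coordinate \<open>0\<close> or \<open>n + 1\<close> lie outside it, so \<open>p - 1\<close>, \<open>q - 1\<close>, \<open>p + 1\<close>, \<open>q + 1\<close> behave as in
  the integers wherever they occur below.
\<close>

definition rk :: "(nat \<Rightarrow> nat) \<Rightarrow> nat \<Rightarrow> nat \<Rightarrow> nat" where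
  "rk w p q = card {k. 1 \<le> k \<and> k \<le> q \<and> w k \<ge> p}"

definition diagram :: "nat \<Rightarrow> (nat \<Rightarrow> nat) \<Rightarrow> (nat \<times> nat) set" where
  "diagram n w = {(p, q). p \<in> {1..n} \<and> q \<in> {1..n} \<and> w q < p \<and> inv_into UNIV w p > q}"

definition essential_set :: "nat \<Rightarrow> (nat \<Rightarrow> nat) \<Rightarrow> (nat \<times> nat) set" where
  "essential_set n w =
     {(p, q). (p, q) \<in> diagram n w \<and> (p, q + 1) \<notin> diagram n w \<and> (p - 1, q) \<notin> diagram n w}"

definition defined_by_inclusions :: "nat \<Rightarrow> (nat \<Rightarrow> nat) \<Rightarrow> bool" where
  "defined_by_inclusions n w \<longleftrightarrow>
     (\<forall>(p, q) \<in> essential_set n w. int q - int (rk w p q) = min (int p - 1) (int q))"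

definition cond_A :: "nat \<Rightarrow> (nat \<Rightarrow> nat) \<Rightarrow> nat \<Rightarrow> nat \<Rightarrow> bool" where
  "cond_A n w p q \<longleftrightarrow> \<not> (\<exists>k\<in>{1..n}. k \<le> q \<and> w k \<ge> p)"

definition cond_B :: "nat \<Rightarrow> (nat \<Rightarrow> nat) \<Rightarrow> nat \<Rightarrow> nat \<Rightarrow> bool" where
  "cond_B n w p q \<longleftrightarrow> \<not> (\<exists>k\<in>{1..n}. k > q \<and> w k < p)"

definition cond_W :: "nat \<Rightarrow> (nat \<Rightarrow> nat) \<Rightarrow> nat \<Rightarrow> nat \<Rightarrow> bool" where
  "cond_W n w p q \<longleftrightarrow>
     (\<forall>p'<p. (p', q) \<notin> essential_set n w) \<and>
     ((p, q - 1) \<notin> diagram n w \<or>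
      (\<exists>p'<p. (p', q - 1) \<in> essential_set n w \<and> cond_B n w p' (q - 1) \<and>
         rk w p' (q - 1) = rk w p q))"

definition cond_X :: "nat \<Rightarrow> (nat \<Rightarrow> nat) \<Rightarrow> nat \<Rightarrow> nat \<Rightarrow> bool" where
  "cond_X n w p q \<longleftrightarrow>
     (\<exists>p'<p. (p', q) \<in> essential_set n w \<and>
        (\<forall>p''<p. (p'', q) \<in> essential_set n w \<longrightarrow> p'' = p') \<and>
        cond_B n w p' q \<and> rk w p' q = rk w p q + 1 \<and>
        (let q' = (LEAST q'. \<forall>b\<in>{q'..q}. (p', b) \<in> diagram n w)
         in (p, q' - 1) \<in> diagram n w))"

definition cond_Y :: "nat \<Rightarrow> (nat \<Rightarrow> nat) \<Rightarrow> nat \<Rightarrow> nat \<Rightarrow> bool" where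
  "cond_Y n w p q \<longleftrightarrow>
     (\<forall>q'>q. (p, q') \<notin> essential_set n w) \<and>
     ((p + 1, q) \<notin> diagram n w \<or>
      (\<exists>q'>q. (p + 1, q') \<in> essential_set n w \<and> cond_B n w (p + 1) q' \<and>
         rk w (p + 1) q' = rk w p q))"

definition cond_Z :: "nat \<Rightarrow> (nat \<Rightarrow> nat) \<Rightarrow> nat \<Rightarrow> nat \<Rightarrow> bool" where
  "cond_Z n w p q \<longleftrightarrow>
     (\<exists>q'>q. (p, q') \<in> essential_set n w \<and>
        (\<forall>q''>q. (p, q'') \<in> essential_set n w \<longrightarrow> q'' = q') \<and>
        cond_B n w p q' \<and> rk w p q' = rk w p q + 1 \<and>
        (let p' = (GREATEST p'. \<forall>a\<in>{p..p'}. (a, q') \<in> diagram n w)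
         in (p' + 1, q) \<in> diagram n w))"

definition almost_defined_by_inclusions :: "nat \<Rightarrow> (nat \<Rightarrow> nat) \<Rightarrow> bool" where
  "almost_defined_by_inclusions n w \<longleftrightarrow>
     (\<forall>(p, q) \<in> essential_set n w.
        cond_A n w p q \<or> cond_B n w p q \<or>
        (cond_W n w p q \<or> cond_X n w p q) \<and> (cond_Y n w p q \<or> cond_Z n w p q))"

text \<open>\<open>E''(w)\<close>:\<close>

definition exceptional_set :: "nat \<Rightarrow> (nat \<Rightarrow> nat) \<Rightarrow> (nat \<times> nat) set" where
  "exceptional_set n w =
     {(p, q). (p, q) \<in> essential_set n w \<and> \<not> cond_A n w p q \<and> \<not> cond_B n w p q}"

text \<open>
  At most one \<open>v\<close> is associated to \<open>w\<close>, since a permutation is determined by its essential set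
  and the ranks there; it is defined by inclusions, as shown at the end of this theory.
\<close>

definition associated_dbi :: "nat \<Rightarrow> (nat \<Rightarrow> nat) \<Rightarrow> (nat \<Rightarrow> nat) \<Rightarrow> bool" where
  "associated_dbi n w v \<longleftrightarrow>
     v permutes {1..n} \<and>
     essential_set n v = essential_set n w - exceptional_set n w \<and>
     (\<forall>(p, q) \<in> essential_set n v. rk v p q = rk w p q)"

text \<open>
  Polynomials in the indeterminates \<open>z\<^bsub>p,q\<^esub>\<close>: the outer map sends a monomial, given by its
  exponents, to its coefficient. \<open>zring n\<close> is the ring \<open>S\<close>, in which only the indeterminates
  with \<open>1 \<le> q < p \<le> n\<close> occur.
\<close>

type_synonym zpoly = "((nat \<times> nat) \<Rightarrow>\<^sub>0 nat) \<Rightarrow>\<^sub>0 complex"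

definition zvar :: "nat \<Rightarrow> nat \<Rightarrow> zpoly" where
  "zvar p q = Poly_Mapping.single (Poly_Mapping.single (p, q) 1) 1"

definition zring :: "nat \<Rightarrow> zpoly ring" where
  "zring n =
     \<lparr>carrier = {f. \<forall>m \<in> Poly_Mapping.keys f. Poly_Mapping.keys m \<subseteq> {(p, q). 1 \<le> q \<and> q < p \<and> p \<le> n}},
      monoid.mult = (*), one = 1, zero = 0, add = (+)\<rparr>"

text \<open>Library matrices are indexed from \<open>0\<close>, hence the shifts in the next two definitions.\<close>

definition zmat :: "nat \<Rightarrow> zpoly mat" where
  "zmat n = mat n n (\<lambda>(i, j). if i > j then zvar (i + 1) (j + 1) else if i = j then 1 else 0)"

definition minor :: "nat \<Rightarrow> nat set \<Rightarrow> nat set \<Rightarrow> zpoly" where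
  "minor n A B = Determinant.det (submatrix (zmat n) {i. i + 1 \<in> A} {j. j + 1 \<in> B})"

definition rank_ideal :: "nat \<Rightarrow> nat \<Rightarrow> nat \<Rightarrow> nat \<Rightarrow> zpoly set" where
  "rank_ideal n p q r =
     Idl\<^bsub>zring n\<^esub> {minor n A B | A B. A \<subseteq> {p..n} \<and> B \<subseteq> {1..q} \<and> card A = r + 1 \<and> card B = r + 1}"

text \<open>The sum of the ideals over \<open>E(v)\<close>, i.e. the ideal generated by their union.\<close>

definition perm_ideal :: "nat \<Rightarrow> (nat \<Rightarrow> nat) \<Rightarrow> zpoly set" where
  "perm_ideal n v = Idl\<^bsub>zring n\<^esub> (\<Union>(p, q) \<in> essential_set n v. rank_ideal n p q (rk v p q))"

definition fpoly :: "nat \<Rightarrow> (nat \<Rightarrow> nat) \<Rightarrow> nat \<Rightarrow> nat \<Rightarrow> zpoly" where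
  "fpoly n w p q = minor n {p..p + rk w p q} {q - rk w p q..q}"

lemma cring_zring: "cring (zring n)"
proof -
  let ?V = "{(p, q). 1 \<le> q \<and> q < p \<and> p \<le> n} :: (nat \<times> nat) set"
  have keys_mult: "Poly_Mapping.keys m \<subseteq> ?V"
    if fg: "f \<in> carrier (zring n)" "g \<in> carrier (zring n)"
      and m: "m \<in> Poly_Mapping.keys (f * g)" for f g m
  proof -
    obtain a b where "m = a + b" "a \<in> Poly_Mapping.keys f" "b \<in> Poly_Mapping.keys g"
      using m Poly_Mapping.keys_mult[of f g] by blast
    moreover have "Poly_Mapping.keys (a + b) \<subseteq> Poly_Mapping.keys a \<union> Poly_Mapping.keys b"
      by (rule Poly_Mapping.keys_add)
    moreover have "Poly_Mapping.keys a \<subseteq> ?V" "Poly_Mapping.keys b \<subseteq> ?V"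
      using fg calculation unfolding zring_def by simp_all
    ultimately show ?thesis by blast
  qed
  have ab: "abelian_group (zring n)"
  proof (rule abelian_groupI)
    fix f g assume "f \<in> carrier (zring n)" "g \<in> carrier (zring n)"
    then show "f \<oplus>\<^bsub>zring n\<^esub> g \<in> carrier (zring n)"
      using Poly_Mapping.keys_add[of f g] unfolding zring_def by (simp add: subset_iff) blast
  next
    fix f assume "f \<in> carrier (zring n)"
    then have "- f \<in> carrier (zring n)" "(- f) \<oplus>\<^bsub>zring n\<^esub> f = \<zero>\<^bsub>zring n\<^esub>"
      by (auto simp: zring_def)
    then show "\<exists>g \<in> carrier (zring n). g \<oplus>\<^bsub>zring n\<^esub> f = \<zero>\<^bsub>zring n\<^esub>" by blast
  qed (auto simp: zring_def algebra_simps)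
  have mon: "comm_monoid (zring n)"
  proof (rule comm_monoidI)
    fix f g assume "f \<in> carrier (zring n)" "g \<in> carrier (zring n)"
    then show "f \<otimes>\<^bsub>zring n\<^esub> g \<in> carrier (zring n)"
      using keys_mult[of f g] by (auto simp: zring_def)
  qed (auto simp: zring_def algebra_simps)
  show ?thesis
    by (rule cringI[OF ab mon]) (auto simp: zring_def algebra_simps)
qed

lemma associated_dbi_defined_by_inclusions:
  assumes w: "w permutes {1..n}" and v: "associated_dbi n w v"
  shows "defined_by_inclusions n v"
proof -
  have "int q - int (rk v p q) = min (int p - 1) (int q)" if e: "(p, q) \<in> essential_set n v" for p q
  proof -
    have rk: "rk v p q = rk w p q" and E: "(p, q) \<in> essential_set n w"
      and AB: "cond_A n w p q \<or> cond_B n w p q"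
      using v e unfolding associated_dbi_def exceptional_set_def by auto
    have pq: "p \<in> {1..n}" "q \<in> {1..n}"
      using E unfolding essential_set_def diagram_def by auto
    define L where "L = {k. 1 \<le> k \<and> k \<le> q \<and> w k < p}"
    have fin: "finite L" "finite {k. 1 \<le> k \<and> k \<le> q \<and> w k \<ge> p}"
      unfolding L_def by (auto intro: finite_subset[of _ "{1..q}"])
    have "{1..q} = L \<union> {k. 1 \<le> k \<and> k \<le> q \<and> w k \<ge> p}" unfolding L_def by auto
    moreover have "L \<inter> {k. 1 \<le> k \<and> k \<le> q \<and> w k \<ge> p} = {}" unfolding L_def by auto
    ultimately have "card {1..q} = card L + rk w p q"
      using card_Un_disjoint[OF fin] unfolding rk_def by simp
    then have q: "q = card L + rk w p q" by simp
    have inj: "inj_on w X" for X using w permutes_inj by (metis inj_on_subset subset_UNIV)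
    have im: "w ` L \<subseteq> {1..<p}"
    proof
      fix x assume "x \<in> w ` L"
      then obtain k where k: "x = w k" "k \<in> {1..n}" "w k < p"
        using pq unfolding L_def by auto
      then have "w k \<in> {1..n}" using permutes_in_image[OF w] by blast
      then show "x \<in> {1..<p}" using k by simp
    qed
    have le: "card L \<le> p - 1"
      using card_mono[OF _ im] card_image[OF inj, of L] by simp
    show ?thesis
    proof (cases "cond_A n w p q")
      case True
      then have "{k. 1 \<le> k \<and> k \<le> q \<and> w k \<ge> p} = {}" using pq unfolding cond_A_def by auto
      then have "rk w p q = 0" unfolding rk_def by (metis card.empty)
      then show ?thesis using q le rk pq by auto
    next
      case False
      then have B: "cond_B n w p q" using AB by blast
      have "{1..<p} \<subseteq> w ` L"
      proof
        fix x assume x: "x \<in> {1..<p}"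
        then have "x \<in> w ` {1..n}" using permutes_image[OF w] pq by auto
        then obtain k where "k \<in> {1..n}" "x = w k" by blast
        moreover from this have "k \<le> q" using B x unfolding cond_B_def by (metis atLeastLessThan_iff not_le)
        ultimately show "x \<in> w ` L" using x unfolding L_def by auto
      qed
      then have "card L = p - 1"
        using im card_image[OF inj, of L] by (metis card_atLeastLessThan subset_antisym)
      then show ?thesis using q rk pq by auto
    qed
  qed
  then show ?thesis unfolding defined_by_inclusions_def by auto
qed

end

theory Submission
  imports Defs
begin

text \<open>
  Write \<open>r\<close> for the rank of \<open>w\<close> at \<open>(p, q)\<close>. Modulo \<open>I\<^sub>v\<close>, every column of the submatrix of \<open>M\<close> with
  rows \<open>{p..n}\<close> and columns \<open>{1..q}\<close> is a combination of its last \<open>r + 1\<close> columns, and every row is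
  a combination of its first \<open>r + 1\<close> rows. Hence each minor of size \<open>r + 1\<close> is congruent to a product
  \<open>det L * f * det C\<close>.

  For the columns, either \<open>q = r + 1\<close> or some \<open>(p', q')\<close> in \<open>E(v)\<close> with \<open>p' \<le> p\<close>, \<open>q' \<le> q\<close> satisfies
  \<open>q' - r' = q - r - 1\<close>, where \<open>r'\<close> is the rank there. As \<open>v\<close> is defined by inclusions, the rows
  \<open>{p'..<p' + r'}\<close> and the columns \<open>{q' - r' + 1..q'}\<close> meet in a unitriangular block, and the minors in
  \<open>I\<^sub>v\<close> that border it express the other columns up to \<open>q'\<close> by those of the block. The rows are dual.
\<close>

section \<open>Diagrams, essential positions and rank counts of a permutation\<close>

lemma diagram_iff:
  assumes "w permutes {1..n}"
  shows "(p, q) \<in> diagram n w \<longleftrightarrow> p \<in> {1..n} \<and> q \<in> {1..n} \<and> w q < p \<and> (\<forall>k\<le>q. w k \<noteq> p)"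
proof -
  have "inv_into UNIV w p > q \<longleftrightarrow> (\<forall>k\<le>q. w k \<noteq> p)"
    using permutes_inverses[OF assms] by (metis not_le)
  then show ?thesis unfolding diagram_def by simp
qed

lemma essential_set_iff:
  "(p, q) \<in> essential_set n w \<longleftrightarrow>
     (p, q) \<in> diagram n w \<and> (p, q + 1) \<notin> diagram n w \<and> (p - 1, q) \<notin> diagram n w"
  unfolding essential_set_def by simp

lemma finite_rk_set: "finite {k. 1 \<le> k \<and> k \<le> q \<and> P k}" for q :: nat
  by (rule finite_subset[of _ "{1..q}"]) auto

lemma rk_mono: "p' \<le> p \<Longrightarrow> q \<le> q' \<Longrightarrow> rk w p q \<le> rk w p' q'"
  unfolding rk_def by (rule card_mono) (auto simp: finite_rk_set)

text \<open>Call the positions \<open>(w k, k)\<close> dots; \<open>rk w p q\<close> counts the dots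
  in row \<open>p\<close> or below, up to column \<open>q\<close>. The two regions compared here are
  nested, so equal finite counts leave no dot in their L-shaped difference.\<close>

lemma rk_eq_region:
  assumes "p' \<le> p" "q \<le> q'" "rk w p q = rk w p' q'" "1 \<le> k" "k \<le> q'" "p' \<le> w k"
  shows "k \<le> q \<and> p \<le> w k"
proof -
  have "{k. 1 \<le> k \<and> k \<le> q \<and> w k \<ge> p} = {k. 1 \<le> k \<and> k \<le> q' \<and> w k \<ge> p'}"
    using assms(1-3) unfolding rk_def by (intro card_subset_eq) (auto simp: finite_rk_set)
  then show ?thesis using assms(4-6) by blast
qed

lemma rk_cong:
  assumes "\<And>k. 1 \<le> k \<Longrightarrow> k \<le> q \<and> p \<le> w k \<longleftrightarrow> k \<le> q' \<and> p' \<le> w k"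
  shows "rk w p q = rk w p' q'"
  unfolding rk_def by (rule arg_cong[of _ _ card]) (use assms in blast)

lemma rk_full_columns:
  assumes "q0 \<le> q" "\<And>b. q0 < b \<Longrightarrow> b \<le> q \<Longrightarrow> p \<le> w b"
  shows "rk w p q = rk w p q0 + (q - q0)"
proof -
  have "{k. 1 \<le> k \<and> k \<le> q \<and> w k \<ge> p} = {k. 1 \<le> k \<and> k \<le> q0 \<and> w k \<ge> p} \<union> {q0<..q}"
    using assms by force
  moreover have "card ({k. 1 \<le> k \<and> k \<le> q0 \<and> w k \<ge> p} \<union> {q0<..q})
      = card {k. 1 \<le> k \<and> k \<le> q0 \<and> w k \<ge> p} + card {q0<..q}"
    by (rule card_Un_disjoint) (auto simp: finite_rk_set)
  ultimately show ?thesis unfolding rk_def by simp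
qed

lemma rk_full_rows:
  assumes "inj w" "w 0 = 0" "1 \<le> p" "p \<le> p0" "\<And>a. p \<le> a \<Longrightarrow> a < p0 \<Longrightarrow> \<exists>k\<le>q. w k = a"
  shows "rk w p q = rk w p0 q + (p0 - p)"
proof -
  define X where "X = {k. 1 \<le> k \<and> k \<le> q \<and> p \<le> w k \<and> w k < p0}"
  have "w ` X = {p..<p0}"
  proof
    show "{p..<p0} \<subseteq> w ` X"
    proof
      fix a assume a: "a \<in> {p..<p0}"
      then obtain k where "k \<le> q" "w k = a" using assms(5) by auto
      \<comment> \<open>The hypothesis admits \<open>k = 0\<close>, which \<open>rk\<close> does not
        count; it is excluded because \<open>w\<close> fixes 0 and \<open>a\<close> is at least
        1.\<close>
      moreover have "k \<noteq> 0" using calculation a assms by (metis atLeastLessThan_iff not_one_le_zero le_trans)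
      ultimately show "a \<in> w ` X" using a unfolding X_def by force
    qed
  qed (auto simp: X_def)
  then have "card X = p0 - p"
    using card_image[of w X] assms(1) by (metis card_atLeastLessThan inj_on_subset subset_UNIV)
  moreover have "{k. 1 \<le> k \<and> k \<le> q \<and> w k \<ge> p} = {k. 1 \<le> k \<and> k \<le> q \<and> w k \<ge> p0} \<union> X"
    using assms unfolding X_def by auto
  moreover have "card ({k. 1 \<le> k \<and> k \<le> q \<and> w k \<ge> p0} \<union> X)
      = card {k. 1 \<le> k \<and> k \<le> q \<and> w k \<ge> p0} + card X"
    by (rule card_Un_disjoint) (auto simp: finite_rk_set X_def)
  ultimately show ?thesis unfolding rk_def by simp
qed

text \<open>Equal ranks empty the L-shaped difference of the two regions. If the diagram position
  were strictly to the right or strictly above, then \<open>(p, q + 1)\<close> or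
  \<open>(p - 1, q)\<close> would be in the diagram, against essentiality.\<close>

lemma essential_set_same_rk:
  assumes w: "w permutes {1..n}" and E: "(p, q) \<in> essential_set n w"
    and D: "(p', q') \<in> diagram n w" and le: "p' \<le> p" "q \<le> q'" and rk: "rk w p q = rk w p' q'"
  shows "p' = p \<and> q' = q"
proof -
  note dg = diagram_iff[OF w]
  have w0: "w 0 = 0" using permutes_not_in[OF w, of 0] by simp
  note reg = rk_eq_region[OF le rk]
  have pq: "p \<in> {1..n}" "q \<in> {1..n}" "w q < p" and row: "\<And>k. k \<le> q \<Longrightarrow> w k \<noteq> p"
    using E unfolding essential_set_iff dg by auto
  have pq': "p' \<in> {1..n}" "q' \<in> {1..n}" using D unfolding dg by auto
  \<comment> \<open>A dot here would lie in the smaller region, hence in row \<open>p\<close> and a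
    column up to \<open>q\<close>, where membership of \<open>(p, q)\<close> in the diagram forbids
    it.\<close>
  have far: "w k \<noteq> a" if "p' \<le> a" "a \<le> p" "k \<le> q'" for a k
  proof
    assume k: "w k = a"
    then have "k \<noteq> 0" using w0 that pq' by (metis atLeastAtMost_iff le_zero_eq not_one_le_zero)
    then have "k \<le> q" "p \<le> w k" using reg[of k] k that by auto
    then show False using row[of k] k that by auto
  qed
  have "\<not> q < q'"
  proof
    assume "q < q'"
    then have "w (q + 1) < p" using reg[of "q + 1"] le(1) by (cases "w (q + 1) < p") auto
    then have "(p, q + 1) \<in> diagram n w" unfolding dg using \<open>q < q'\<close> pq pq' far[of p] le by auto
    then show False using E unfolding essential_set_iff by blast
  qed
  moreover have "\<not> p' < p"
  proof
    assume "p' < p"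
    then have "w q < p - 1" using far[of "p - 1" q] pq le by linarith
    then have "(p - 1, q) \<in> diagram n w"
      unfolding dg using \<open>p' < p\<close> pq pq' far[of "p - 1"] le by auto
    then show False using E unfolding essential_set_iff by blast
  qed
  ultimately show ?thesis using le by simp
qed

text \<open>The top end of the run satisfies the upper condition of essentiality, so a user of this
  walk only has to check the right neighbour.\<close>

lemma diagram_vertical_run:
  assumes "(p, q) \<in> diagram n w"
  obtains p' where "p' \<le> p" "\<And>a. p' \<le> a \<Longrightarrow> a \<le> p \<Longrightarrow> (a, q) \<in> diagram n w" "(p' - 1, q) \<notin> diagram n w"
proof -
  define P where "P x \<longleftrightarrow> x \<le> p \<and> (\<forall>a. x \<le> a \<longrightarrow> a \<le> p \<longrightarrow> (a, q) \<in> diagram n w)" for x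
  have "P p" using assms unfolding P_def by (metis le_antisym le_refl)
  then obtain x where P: "P x" and min: "\<And>y. P y \<Longrightarrow> x \<le> y"
    using LeastI[of P p] Least_le[of P] by blast
  have "(x - 1, q) \<notin> diagram n w"
  proof
    assume D: "(x - 1, q) \<in> diagram n w"
    then have "x - 1 \<noteq> 0" by (auto simp: diagram_def)
    moreover have "(a, q) \<in> diagram n w" if "x - 1 \<le> a" "a \<le> p" for a
      using D P that unfolding P_def by (cases "a = x - 1") auto
    then have "P (x - 1)" using P unfolding P_def by simp
    ultimately show False using min[of "x - 1"] by simp
  qed
  then show ?thesis using P that[of x] unfolding P_def by blast
qed

text \<open>The dual walk, which stops at column \<open>n\<close> at the latest; at its end only the
  upper neighbour remains to be checked.\<close>

lemma diagram_horizontal_run: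
  assumes "(p, q) \<in> diagram n w"
  obtains q' where "q \<le> q'" "\<And>b. q \<le> b \<Longrightarrow> b \<le> q' \<Longrightarrow> (p, b) \<in> diagram n w" "(p, q' + 1) \<notin> diagram n w"
proof -
  define P where "P x \<longleftrightarrow> q \<le> x \<and> (p, x + 1) \<notin> diagram n w" for x
  have "q \<le> n" "(p, n + 1) \<notin> diagram n w" using assms by (auto simp: diagram_def)
  then have "P n" unfolding P_def by simp
  then obtain x where P: "P x" and min: "\<And>y. P y \<Longrightarrow> x \<le> y"
    using LeastI[of P n] Least_le[of P] by blast
  have "(p, b) \<in> diagram n w" if "q \<le> b" "b \<le> x" for b
  proof (cases "b = q")
    case False
    then have "\<not> P (b - 1)" using min[of "b - 1"] that by auto
    then show ?thesis using that False unfolding P_def by auto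
  qed (use assms in simp)
  then show ?thesis using P that[of x] unfolding P_def by blast
qed

section \<open>Pivot positions for the columns and for the rows\<close>

text \<open>If the left neighbour of \<open>(p, q)\<close> is in the diagram, W or X names the
  pivot. Otherwise walk left along row \<open>p\<close> to the nearest diagram position
  \<open>(p, q0)\<close>, then up its column to an essential position. Were that one exceptional,
  its own condition Y or Z would contradict the dots between \<open>q0\<close> and \<open>q\<close>
  or the failure of B at \<open>(p, q)\<close>.\<close>

lemma column_pivot:
  assumes w: "w permutes {1..n}" and adbi: "almost_defined_by_inclusions n w"
    and ex: "(p, q) \<in> exceptional_set n w"
  shows "q = rk w p q + 1 \<or>
    (\<exists>p' q'. (p', q') \<in> essential_set n w - exceptional_set n w \<and> p' \<le> p \<and> q' \<le> q \<and>
       q' + rk w p q + 1 = q + rk w p' q')"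
    (is "_ \<or> ?thesis")
proof -
  note dg = diagram_iff[OF w]
  define r where "r = rk w p q"
  have E: "(p, q) \<in> essential_set n w" and nA: "\<not> cond_A n w p q" and nB: "\<not> cond_B n w p q"
    using ex unfolding exceptional_set_def by auto
  have pq: "p \<in> {1..n}" "q \<in> {1..n}" "w q < p" and row: "\<And>k. k \<le> q \<Longrightarrow> w k \<noteq> p"
    using E unfolding essential_set_iff dg by auto
  have cond: "(cond_W n w p q \<or> cond_X n w p q) \<and> (cond_Y n w p q \<or> cond_Z n w p q)"
    if "(p, q) \<in> essential_set n w" "\<not> cond_A n w p q" "\<not> cond_B n w p q" for p q
    using adbi that unfolding almost_defined_by_inclusions_def by blast
  \<comment> \<open>A position satisfying B is not exceptional, so only its location and rank need
    checking.\<close>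
  have Bpt: "?thesis" if "(p', q') \<in> essential_set n w" "cond_B n w p' q'" "p' \<le> p" "q' \<le> q"
    "q' + r + 1 = q + rk w p' q'" for p' q'
    using that unfolding exceptional_set_def r_def by blast
  show ?thesis
  proof (cases "(p, q - 1) \<in> diagram n w")
    case True
    consider "cond_W n w p q" | "cond_X n w p q" using cond[OF E nA nB] by blast
    then show ?thesis
    proof cases
      case 1
      then obtain p' where "p' < p" "(p', q - 1) \<in> essential_set n w" "cond_B n w p' (q - 1)"
         "rk w p' (q - 1) = r"
        using True unfolding cond_W_def r_def by blast
      then show ?thesis using Bpt[of p' "q - 1"] pq by simp
    next
      case 2
      then obtain p' where "p' < p" "(p', q) \<in> essential_set n w" "cond_B n w p' q"
         "rk w p' q = r + 1"
        unfolding cond_X_def r_def by blast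
      then show ?thesis using Bpt[of p' q] by simp
    qed
  next
    case notD: False
    \<comment> \<open>The sentinel \<open>b = 0\<close> makes the maximum exist and stands for a row
      with no diagram position left of \<open>q\<close>.\<close>
    define P where "P b \<longleftrightarrow> b < q \<and> (b = 0 \<or> (p, b) \<in> diagram n w)" for b
    have "P 0" "\<And>b. P b \<Longrightarrow> b \<le> q" using pq unfolding P_def by auto
    then obtain q0 where q0: "P q0" and q0_max: "\<And>b. P b \<Longrightarrow> b \<le> q0"
      using GreatestI_nat[of P 0 q] Greatest_le_nat[of P _ q] by blast
    \<comment> \<open>Row \<open>p\<close> has no dot up to column \<open>q\<close>, so such a
      column can miss the diagram only by having its dot below row \<open>p\<close>.\<close>
    have full: "p \<le> w b" if "q0 < b" "b < q" for b
    proof (rule ccontr)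
      assume "\<not> p \<le> w b"
      then have "(p, b) \<in> diagram n w" unfolding dg using that pq row by auto
      then show False using q0_max[of b] that unfolding P_def by simp
    qed
    \<comment> \<open>Column \<open>q\<close> contributes nothing, as \<open>w q < p\<close>; hence
      the count runs to \<open>q - 1\<close>.\<close>
    have "rk w p q = rk w p (q - 1)"
    proof (rule rk_cong)
      fix k
      show "k \<le> q \<and> p \<le> w k \<longleftrightarrow> k \<le> q - 1 \<and> p \<le> w k"
        using pq by (cases "k = q") auto
    qed
    also have "\<dots> = rk w p q0 + (q - 1 - q0)"
      using q0 full by (intro rk_full_columns) (auto simp: P_def)
    finally have r: "r = rk w p q0 + (q - 1 - q0)" unfolding r_def .
    show ?thesis
    proof (cases "q0 = 0")
      case True
      then have "rk w p q0 = 0" by (simp add: rk_def)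
      then show ?thesis using r True pq unfolding r_def by auto
    next
      case False
      then have D0: "(p, q0) \<in> diagram n w" and "q0 < q" using q0 unfolding P_def by auto
      then have q0q: "q0 < q - 1" using notD by (metis Suc_pred' le_neq_implies_less less_Suc_eq_le not_gr_zero not_less_zero)
      obtain p' where p': "p' \<le> p" and run: "\<And>a. p' \<le> a \<Longrightarrow> a \<le> p \<Longrightarrow> (a, q0) \<in> diagram n w"
        and top: "(p' - 1, q0) \<notin> diagram n w"
        using diagram_vertical_run[OF D0] by blast
      have "(p', q0 + 1) \<notin> diagram n w" using full[of "q0 + 1"] q0q p' unfolding dg by simp linarith
      then have E': "(p', q0) \<in> essential_set n w" using run p' top unfolding essential_set_iff by blast
      \<comment> \<open>The rows of the run have no dots up to column \<open>q0\<close>, so climbing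
        keeps the rank.\<close>
      have rk': "rk w p' q0 = rk w p q0"
      proof (rule rk_cong)
        fix k :: nat
        have "w k \<noteq> a" if "p' \<le> a" "a \<le> p" "k \<le> q0" for a using run[of a] that unfolding dg by auto
        then show "k \<le> q0 \<and> p' \<le> w k \<longleftrightarrow> k \<le> q0 \<and> p \<le> w k" using p' by (metis le_trans linorder_le_cases)
      qed
      show ?thesis
      proof (cases "(p', q0) \<in> exceptional_set n w")
        case False
        then have "(p', q0) \<in> essential_set n w - exceptional_set n w" "p' \<le> p" "q0 \<le> q"
          "q0 + rk w p q + 1 = q + rk w p' q0"
          using E' p' rk' r q0q unfolding r_def by auto
        then show ?thesis by blast
      next
        case True
        then consider "cond_Y n w p' q0" | "cond_Z n w p' q0"
          using cond unfolding exceptional_set_def by blast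
        then show ?thesis
        proof cases
          case 1
          \<comment> \<open>With \<open>p' = p\<close>, the essential position \<open>(p, q)\<close>
            would violate the first clause of Y. So the run contains \<open>(p' + 1, q0)\<close>,
            and the second clause must hold through its existential part.\<close>
          then have "p' \<noteq> p" using E q0q unfolding cond_Y_def by (metis less_diff_conv add_lessD1)
          then obtain q' where q': "q' > q0" "(p' + 1, q') \<in> essential_set n w" "rk w (p' + 1) q' = rk w p' q0"
            using 1 run[of "p' + 1"] p' unfolding cond_Y_def by auto
          \<comment> \<open>Columns strictly between \<open>q0\<close> and \<open>q\<close> have
            their dots too low, so \<open>q'\<close> is at least \<open>q\<close> and the rank there
            at least \<open>r\<close>. Yet Y equates it with the rank at \<open>q0\<close>, which is
            smaller by \<open>q - 1 - q0\<close>, a positive number.\<close>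
          have "w q' < p' + 1" using q' unfolding essential_set_iff dg by auto
          then have "q \<le> q'" using full[of q'] q' p' \<open>p' \<noteq> p\<close> by force
          then have "r \<le> rk w (p' + 1) q'" unfolding r_def using p' \<open>p' \<noteq> p\<close> by (intro rk_mono) auto
          then show ?thesis using r rk' q' q0q by simp
        next
          case 2
          then obtain q' where q': "q' > q0" "(p', q') \<in> essential_set n w" "cond_B n w p' q'"
              "rk w p' q' = rk w p' q0 + 1"
            unfolding cond_Z_def by blast
          have "w q' < p'" using q' unfolding essential_set_iff dg by auto
          then have "q \<le> q'" using full[of q'] q' p' by force
          then have "r \<le> rk w p' q'" unfolding r_def using p' by (intro rk_mono)
          \<comment> \<open>One inequality is monotonicity. The other holds because a full column
            lies between \<open>q0\<close> and \<open>q\<close>, so that the rank at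
            \<open>q0\<close> is at most \<open>r - 1\<close>. Equal ranks then identify
            \<open>(p', q')\<close>, where B holds, with \<open>(p, q)\<close>, where it
            fails.\<close>
          then have "rk w p q = rk w p' q'" using r rk' q' q0q unfolding r_def by simp
          then have "p' = p \<and> q' = q"
            using essential_set_same_rk[OF w E] q' p' \<open>q \<le> q'\<close> unfolding essential_set_iff by blast
          then show ?thesis using q' nB by simp
        qed
      qed
    qed
  qed
qed

text \<open>Dual to \<open>column_pivot\<close>. If the position below \<open>(p, q)\<close> is in
  the diagram, Y or Z names the pivot; otherwise walk down column \<open>q\<close> to the next
  diagram position and right along its row, and let W or X rule out an exceptional end.\<close>

lemma row_pivot:
  assumes w: "w permutes {1..n}" and adbi: "almost_defined_by_inclusions n w"
    and ex: "(p, q) \<in> exceptional_set n w"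
  shows "p + rk w p q = n \<or>
    (\<exists>p' q'. (p', q') \<in> essential_set n w - exceptional_set n w \<and> p \<le> p' \<and> q \<le> q' \<and>
       p' + rk w p' q' = p + rk w p q + 1)"
    (is "_ \<or> ?thesis")
proof -
  note dg = diagram_iff[OF w]
  define r where "r = rk w p q"
  have w0: "w 0 = 0" using permutes_not_in[OF w, of 0] by simp
  have E: "(p, q) \<in> essential_set n w" and nA: "\<not> cond_A n w p q" and nB: "\<not> cond_B n w p q"
    using ex unfolding exceptional_set_def by auto
  have pq: "p \<in> {1..n}" "q \<in> {1..n}" "w q < p" and row: "\<And>k. k \<le> q \<Longrightarrow> w k \<noteq> p"
    using E unfolding essential_set_iff dg by auto
  have wn: "w k \<le> n" if "k \<le> q" for k
    using permutes_in_image[OF w, of k] w0 that pq by (cases "k = 0") auto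
  have cond: "(cond_W n w p q \<or> cond_X n w p q) \<and> (cond_Y n w p q \<or> cond_Z n w p q)"
    if "(p, q) \<in> essential_set n w" "\<not> cond_A n w p q" "\<not> cond_B n w p q" for p q
    using adbi that unfolding almost_defined_by_inclusions_def by blast
  have Bpt: "?thesis" if "(p', q') \<in> essential_set n w" "cond_B n w p' q'" "p \<le> p'" "q \<le> q'"
    "p' + rk w p' q' = p + r + 1" for p' q'
    using that unfolding exceptional_set_def r_def by blast
  show ?thesis
  proof (cases "(p + 1, q) \<in> diagram n w")
    case True
    consider "cond_Y n w p q" | "cond_Z n w p q" using cond[OF E nA nB] by blast
    then show ?thesis
    proof cases
      case 1
      then obtain q' where "q < q'" "(p + 1, q') \<in> essential_set n w" "cond_B n w (p + 1) q'"
         "rk w (p + 1) q' = r"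
        using True unfolding cond_Y_def r_def by blast
      then show ?thesis using Bpt[of "p + 1" q'] by simp
    next
      case 2
      then obtain q' where "q < q'" "(p, q') \<in> essential_set n w" "cond_B n w p q'"
         "rk w p q' = r + 1"
        unfolding cond_Z_def r_def by blast
      then show ?thesis using Bpt[of p q'] by simp
    qed
  next
    case notD: False
    \<comment> \<open>The sentinel \<open>n + 1\<close> stands for a column with no diagram position
      below row \<open>p\<close>; the rank at that row is 0.\<close>
    define P where "P a \<longleftrightarrow> p < a \<and> (a = n + 1 \<or> (a, q) \<in> diagram n w)" for a
    have "P (n + 1)" using pq unfolding P_def by auto
    then obtain p0 where p0: "P p0" and p0_min: "\<And>a. P a \<Longrightarrow> p0 \<le> a"
      using LeastI[of P "n + 1"] Least_le[of P] by blast
    then have p0n: "p0 \<le> n + 1" using \<open>P (n + 1)\<close> by blast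
    have full: "\<exists>k\<le>q. w k = a" if "p < a" "a < p0" for a
    proof (rule ccontr)
      assume "\<not> (\<exists>k\<le>q. w k = a)"
      then have "(a, q) \<in> diagram n w" unfolding dg using that pq p0n by auto
      then show False using p0_min[of a] that unfolding P_def by simp
    qed
    \<comment> \<open>Row \<open>p\<close> contributes nothing: its dot lies to the right of column
      \<open>q\<close>.\<close>
    have "rk w p q = rk w (p + 1) q"
    proof (rule rk_cong)
      fix k :: nat
      show "k \<le> q \<and> p \<le> w k \<longleftrightarrow> k \<le> q \<and> p + 1 \<le> w k"
        using row[of k] by auto
    qed
    also have "\<dots> = rk w p0 q + (p0 - (p + 1))"
      using p0 full w0 permutes_inj[OF w] by (intro rk_full_rows) (auto simp: P_def)
    finally have r: "r = rk w p0 q + (p0 - (p + 1))" unfolding r_def .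
    show ?thesis
    proof (cases "p0 = n + 1")
      case True
      have "{k. 1 \<le> k \<and> k \<le> q \<and> w k \<ge> p0} = {}" using wn True by force
      then have "rk w p0 q = 0" by (simp only: rk_def card.empty)
      then show ?thesis using r True pq unfolding r_def by auto
    next
      case False
      then have D0: "(p0, q) \<in> diagram n w" and "p < p0" using p0 unfolding P_def by auto
      then have p0p: "p + 1 < p0" using notD by (metis Suc_eq_plus1 Suc_lessI)
      obtain q' where q': "q \<le> q'" and run: "\<And>b. q \<le> b \<Longrightarrow> b \<le> q' \<Longrightarrow> (p0, b) \<in> diagram n w"
        and right: "(p0, q' + 1) \<notin> diagram n w"
        using diagram_horizontal_run[OF D0] by blast
      have "(p0 - 1, q') \<notin> diagram n w" using full[of "p0 - 1"] p0p q' unfolding dg by force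
      then have E': "(p0, q') \<in> essential_set n w" using run q' right unfolding essential_set_iff by blast
      have rk': "rk w p0 q' = rk w p0 q"
      proof (rule rk_cong)
        fix k :: nat
        have "w k < p0" if "q \<le> k" "k \<le> q'" using run[of k] that unfolding dg by auto
        then show "k \<le> q' \<and> p0 \<le> w k \<longleftrightarrow> k \<le> q \<and> p0 \<le> w k" using q' by force
      qed
      \<comment> \<open>Rows strictly between \<open>p\<close> and \<open>p0\<close> have their dots
        in columns up to \<open>q\<close>, hence do not meet the diagram from column
        \<open>q\<close> on. This pushes the position named by W or X up to row \<open>p\<close> or
        higher.\<close>
      have above: "a \<le> p" if ab: "(a, b) \<in> diagram n w" "q \<le> b" "a < p0" for a b
      proof (rule ccontr)
        assume "\<not> a \<le> p"
        then have "p < a" by simp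
        then obtain k where "k \<le> q" "w k = a" using full[of a] ab by blast
        then show False using ab unfolding dg by auto
      qed
      show ?thesis
      proof (cases "(p0, q') \<in> exceptional_set n w")
        case False
        then have "(p0, q') \<in> essential_set n w - exceptional_set n w" "p \<le> p0" "q \<le> q'"
          "p0 + rk w p0 q' = p + rk w p q + 1"
          using E' q' rk' r p0p unfolding r_def by auto
        then show ?thesis by blast
      next
        case True
        then consider "cond_W n w p0 q'" | "cond_X n w p0 q'"
          using cond unfolding exceptional_set_def by blast
        then show ?thesis
        proof cases
          case 1
          \<comment> \<open>Otherwise \<open>(p, q)\<close> would be an essential position above
            \<open>(p0, q')\<close> in the same column, against the first clause of W.\<close>
          then have "q' \<noteq> q" using E \<open>p < p0\<close> unfolding cond_W_def by blast
          then obtain p' where p': "p' < p0" "(p', q' - 1) \<in> essential_set n w" "rk w p' (q' - 1) = rk w p0 q'"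
            using 1 run[of "q' - 1"] q' unfolding cond_W_def by auto
          have "p' \<le> p" using above[of p' "q' - 1"] p' q' \<open>q' \<noteq> q\<close> unfolding essential_set_iff by auto
          then have "r \<le> rk w p' (q' - 1)" unfolding r_def using q' \<open>q' \<noteq> q\<close> by (intro rk_mono) auto
          then show ?thesis using r rk' p' p0p by simp
        next
          case 2
          then obtain p' where p': "p' < p0" "(p', q') \<in> essential_set n w" "cond_B n w p' q'"
              "rk w p' q' = rk w p0 q' + 1"
            unfolding cond_X_def by blast
          have "p' \<le> p" using above[of p' q'] p' q' unfolding essential_set_iff by auto
          then have "r \<le> rk w p' q'" unfolding r_def using q' by (intro rk_mono)
          then have "rk w p q = rk w p' q'" using r rk' p' p0p unfolding r_def by simp
          then have "p' = p \<and> q' = q"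
            using essential_set_same_rk[OF w E] p' q' \<open>p' \<le> p\<close> unfolding essential_set_iff by blast
          then show ?thesis using p' nB by simp
        qed
      qed
    qed
  qed
qed


section \<open>Schur complements modulo an ideal\<close>

text \<open>This is \<open>U\<close> with a column \<open>x\<close> in front, a row \<open>y\<close>
  below and the corner \<open>t\<close>. Clearing \<open>x\<close> by column operations leaves the
  Schur complement \<open>t - y V x\<close> in the corner; the sign comes from its place in row
  \<open>r\<close> and column 0.\<close>

lemma det_bordered:
  fixes U V :: "'a :: comm_ring_1 mat"
  assumes U: "U \<in> carrier_mat r r" and V: "V \<in> carrier_mat r r"
    and inv: "U * V = 1\<^sub>m r" and det: "det U = 1"
  shows "det (mat (Suc r) (Suc r) (\<lambda>(a, c).
             if a < r then (if c = 0 then x a else U $$ (a, c - 1))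
             else (if c = 0 then t else y (c - 1))))
         = (- 1) ^ r * (t - (\<Sum>b<r. \<Sum>a<r. y b * V $$ (b, a) * x a))"
proof -
  define N where "N = mat (Suc r) (Suc r) (\<lambda>(a, c).
             if a < r then (if c = 0 then x a else U $$ (a, c - 1))
             else (if c = 0 then t else y (c - 1)))"
  define u where "u b = (\<Sum>a<r. V $$ (b, a) * x a)" for b
  \<comment> \<open>Right multiplication by \<open>T\<close> subtracts from column 0 the combination
    of the later columns with coefficients \<open>u = V x\<close>, which reproduces \<open>x\<close>
    on the rows of \<open>U\<close>.\<close>
  define T where "T = mat (Suc r) (Suc r) (\<lambda>(c, d).
             if d = 0 then (if c = 0 then 1 else - u (c - 1)) else if c = d then 1 else 0)"
  have N: "N \<in> carrier_mat (Suc r) (Suc r)" and T: "T \<in> carrier_mat (Suc r) (Suc r)"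
    unfolding N_def T_def by auto
  have "det T = prod_list (diag_mat T)"
    by (rule det_lower_triangular[OF _ T]) (auto simp: T_def)
  also have "diag_mat T = map (\<lambda>_. 1) [0..<Suc r]"
    unfolding diag_mat_def by (rule map_cong) (auto simp: T_def)
  also have "prod_list \<dots> = (1 :: 'a)" by (induction r) simp_all
  finally have detT: "det T = 1" .
  have NT: "(N * T) $$ (a, d) = (\<Sum>c<Suc r. N $$ (a, c) * T $$ (c, d))"
    if "a < Suc r" "d < Suc r" for a d
    using that N T by (auto simp: scalar_prod_def atLeast0LessThan)
  have UV: "(\<Sum>b<r. U $$ (a, b) * V $$ (b, a')) = (if a = a' then 1 else 0)"
    if "a < r" "a' < r" for a a'
  proof -
    have "(\<Sum>b<r. U $$ (a, b) * V $$ (b, a')) = (U * V) $$ (a, a')"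
      using that U V by (auto simp: scalar_prod_def atLeast0LessThan)
    then show ?thesis using inv that by simp
  qed
  have Uu: "(\<Sum>b<r. U $$ (a, b) * u b) = x a" if "a < r" for a
  proof -
    have "(\<Sum>b<r. U $$ (a, b) * u b) = (\<Sum>b<r. \<Sum>a'<r. U $$ (a, b) * V $$ (b, a') * x a')"
      unfolding u_def by (simp add: sum_distrib_left mult.assoc)
    also have "\<dots> = (\<Sum>a'<r. (\<Sum>b<r. U $$ (a, b) * V $$ (b, a')) * x a')"
      by (subst sum.swap) (simp add: sum_distrib_right)
    also have "\<dots> = (\<Sum>a'<r. if a = a' then x a' else 0)"
      using UV[OF that] by (intro sum.cong) auto
    finally show ?thesis using that by simp
  qed
  have col0: "(N * T) $$ (a, 0) = 0" if "a < r" for a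
  proof -
    have "(N * T) $$ (a, 0) = x a - (\<Sum>b<r. U $$ (a, b) * u b)"
      using that unfolding NT[OF less_SucI[OF that] zero_less_Suc] sum.lessThan_Suc_shift
      by (simp add: N_def T_def sum_negf)
    then show ?thesis using Uu[OF that] by simp
  qed
  have corner: "(N * T) $$ (r, 0) = t - (\<Sum>b<r. y b * u b)"
    unfolding NT[OF lessI zero_less_Suc] sum.lessThan_Suc_shift
    by (simp add: N_def T_def sum_negf)
  have rest: "(N * T) $$ (a, Suc d) = U $$ (a, d)" if "a < r" "d < r" for a d
  proof -
    have "(N * T) $$ (a, Suc d) = (\<Sum>c<r. N $$ (a, Suc c) * T $$ (Suc c, Suc d))"
      using that unfolding NT[OF less_SucI[OF that(1)] Suc_mono[OF that(2)]] sum.lessThan_Suc_shift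
      by (simp add: T_def)
    also have "\<dots> = (\<Sum>c<r. if c = d then U $$ (a, c) else 0)"
      using that by (intro sum.cong) (auto simp: N_def T_def)
    finally show ?thesis using that by simp
  qed
  have NTc: "N * T \<in> carrier_mat (Suc r) (Suc r)" using N T by simp
  have del: "mat_delete (N * T) r 0 = U"
  proof (rule eq_matI)
    fix i j assume "i < dim_row U" "j < dim_col U"
    then have ij: "i < r" "j < r" using U by auto
    then have "mat_delete (N * T) r 0 $$ (i, j) = (N * T) $$ (i, Suc j)"
      using N T unfolding mat_delete_def by simp
    then show "mat_delete (N * T) r 0 $$ (i, j) = U $$ (i, j)" using rest[OF ij] by simp
  qed (use U N T in \<open>auto simp: mat_delete_def\<close>)
  have "det N = det (N * T)" using det_mult[OF N T] detT by simp
  also have "\<dots> = (\<Sum>a<Suc r. (N * T) $$ (a, 0) * cofactor (N * T) a 0)"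
    by (rule laplace_expansion_column[OF NTc]) simp
  also have "\<dots> = (t - (\<Sum>b<r. y b * u b)) * (- 1) ^ r"
    using col0 corner det unfolding cofactor_def by (simp add: del)
  also have "(\<Sum>b<r. y b * u b) = (\<Sum>b<r. \<Sum>a<r. y b * V $$ (b, a) * x a)"
    unfolding u_def by (simp add: sum_distrib_left mult.assoc)
  finally show ?thesis unfolding N_def by (simp add: mult.commute)
qed

text \<open>Determinants are taken in the whole type, whereas the ideals belong to the subring
  \<open>S\<close>. So \<open>J\<close> absorbs only factors from \<open>S\<close>, and membership
  of every coefficient in \<open>S\<close> has to be tracked.\<close>

locale subring_ideal =
  fixes S J :: "'a :: comm_ring_1 set"
  assumes S_one: "1 \<in> S" and S_zero: "0 \<in> S"
    and S_add: "a \<in> S \<Longrightarrow> b \<in> S \<Longrightarrow> a + b \<in> S"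
    and S_mult: "a \<in> S \<Longrightarrow> b \<in> S \<Longrightarrow> a * b \<in> S"
    and S_uminus: "a \<in> S \<Longrightarrow> - a \<in> S"
    and J_zero: "0 \<in> J"
    and J_add: "x \<in> J \<Longrightarrow> y \<in> J \<Longrightarrow> x + y \<in> J"
    and J_mult: "a \<in> S \<Longrightarrow> x \<in> J \<Longrightarrow> a * x \<in> J"
begin

lemma J_uminus: "x \<in> J \<Longrightarrow> - x \<in> J"
  using J_mult[OF S_uminus[OF S_one]] by simp

lemma S_sum: "(\<And>i. i \<in> A \<Longrightarrow> f i \<in> S) \<Longrightarrow> sum f A \<in> S"
  by (induction A rule: infinite_finite_induct) (auto intro: S_zero S_add)

lemma S_prod: "(\<And>i. i \<in> A \<Longrightarrow> f i \<in> S) \<Longrightarrow> prod f A \<in> S"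
  by (induction A rule: infinite_finite_induct) (auto intro: S_one S_mult)

lemma J_sum: "(\<And>i. i \<in> A \<Longrightarrow> f i \<in> J) \<Longrightarrow> sum f A \<in> J"
  by (induction A rule: infinite_finite_induct) (auto intro: J_zero J_add)

lemma S_sign: "(signof s :: 'a) \<in> S"
  using S_one S_uminus by (simp add: sign_def)

lemma prod_cong_J:
  assumes "\<And>i. i \<in> A \<Longrightarrow> f i \<in> S" "\<And>i. i \<in> A \<Longrightarrow> g i \<in> S" "\<And>i. i \<in> A \<Longrightarrow> f i - g i \<in> J"
  shows "prod f A - prod g A \<in> J"
  using assms
proof (induction A rule: infinite_finite_induct)
  case (insert i A)
  have "prod f (insert i A) - prod g (insert i A)
      = prod f A * (f i - g i) + g i * (prod f A - prod g A)"
    using insert by (simp add: algebra_simps)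
  also have "\<dots> \<in> J" using insert by (intro J_add J_mult S_prod) auto
  finally show ?case .
qed (auto intro: J_zero)

lemma det_in_S:
  assumes M: "M \<in> carrier_mat m m" and "\<And>i j. i < m \<Longrightarrow> j < m \<Longrightarrow> M $$ (i, j) \<in> S"
  shows "det M \<in> S"
  unfolding det_def'[OF M]
  by (intro S_sum S_mult S_sign S_prod assms(2)) (auto simp: permutes_def dest: permutes_in_image)

text \<open>By the Leibniz formula the difference is a signed sum of differences of products, each
  covered by \<open>prod_cong_J\<close>.\<close>

lemma det_cong_J:
  assumes X: "X \<in> carrier_mat m m" and Y: "Y \<in> carrier_mat m m"
    and "\<And>i j. i < m \<Longrightarrow> j < m \<Longrightarrow> X $$ (i, j) \<in> S"
    and "\<And>i j. i < m \<Longrightarrow> j < m \<Longrightarrow> Y $$ (i, j) \<in> S"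
    and "\<And>i j. i < m \<Longrightarrow> j < m \<Longrightarrow> X $$ (i, j) - Y $$ (i, j) \<in> J"
  shows "det X - det Y \<in> J"
  unfolding det_def'[OF X] det_def'[OF Y] sum_subtractf[symmetric] right_diff_distrib[symmetric]
proof (intro J_sum J_mult S_sign prod_cong_J)
qed (use assms(3-5) in \<open>auto dest: permutes_in_image\<close>)

text \<open>The assumption concerns an extra row below the block and an extra column to its left.
  For every other row and column in range the bordered matrix has two equal rows or columns, hence
  determinant 0. The adjugate inverts the block inside \<open>S\<close>, since the determinant is
  1.\<close>

lemma schur_complement_J:
  assumes S: "\<And>i j. F i j \<in> S"
    and det: "det (mat r r (\<lambda>(a, b). F (P + a) (Q + b))) = 1"
    and minors: "\<And>i j. P + r \<le> i \<Longrightarrow> i \<le> n \<Longrightarrow> 1 \<le> j \<Longrightarrow> j < Q \<Longrightarrow>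
      det (mat (Suc r) (Suc r) (\<lambda>(a, c). F (if a < r then P + a else i) (if c = 0 then j else Q + (c - 1)))) \<in> J"
  obtains V where "\<And>b a. V b a \<in> S"
    "\<And>i j. P \<le> i \<Longrightarrow> i \<le> n \<Longrightarrow> 1 \<le> j \<Longrightarrow> j < Q + r \<Longrightarrow>
       F i j - (\<Sum>b<r. \<Sum>a<r. F i (Q + b) * V b a * F (P + a) j) \<in> J"
proof -
  define U where "U = mat r r (\<lambda>(a, b). F (P + a) (Q + b))"
  \<comment> \<open>The value 0 outside the block makes membership in \<open>S\<close> hold for all
    indices.\<close>
  define V where "V b a = (if b < r \<and> a < r then adj_mat U $$ (b, a) else 0)" for b a
  have U: "U \<in> carrier_mat r r" unfolding U_def by simp
  have UV: "U * adj_mat U = 1\<^sub>m r" using adj_mat(2)[OF U] det unfolding U_def by (auto intro!: eq_matI)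
  have "V b a \<in> S" for b a
  proof (cases "b < r \<and> a < r")
    case True
    have "det (mat_delete U a b) \<in> S"
    proof (rule det_in_S)
      show "mat_delete U a b \<in> carrier_mat (r - 1) (r - 1)" using U unfolding mat_delete_def by auto
      show "mat_delete U a b $$ (i, j) \<in> S" if "i < r - 1" "j < r - 1" for i j
        using that True S unfolding mat_delete_def U_def by auto
    qed
    moreover have "(- 1) ^ k \<in> S" for k
      by (induction k) (auto intro: S_one S_uminus)
    ultimately show ?thesis
      using True U unfolding V_def adj_mat_def cofactor_def by (auto intro: S_mult)
  qed (auto simp: V_def S_zero)
  moreover have "F i j - (\<Sum>b<r. \<Sum>a<r. F i (Q + b) * V b a * F (P + a) j) \<in> J"
    if ij: "P \<le> i" "i \<le> n" "1 \<le> j" "j < Q + r" for i j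
  proof -
    define N where "N = mat (Suc r) (Suc r)
      (\<lambda>(a, c). F (if a < r then P + a else i) (if c = 0 then j else Q + (c - 1)))"
    have Nc: "N \<in> carrier_mat (Suc r) (Suc r)" unfolding N_def by simp
    have "det N \<in> J"
    proof (cases "P + r \<le> i \<and> j < Q")
      case True
      then show ?thesis using minors ij unfolding N_def by simp
    next
      case False
      then consider "i < P + r" | "Q \<le> j" by linarith
      then have "det N = 0"
      proof cases
        case 1
        show ?thesis
          by (rule det_identical_rows[OF Nc, of "i - P" r])
            (use 1 ij in \<open>auto simp: N_def intro!: eq_vecI\<close>)
      next
        case 2
        show ?thesis
          by (rule det_identical_columns[OF Nc, of 0 "Suc (j - Q)"])
            (use 2 ij in \<open>auto simp: N_def intro!: eq_vecI\<close>)
      qed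
      then show ?thesis using J_zero by simp
    qed
    moreover have "N = mat (Suc r) (Suc r) (\<lambda>(a, c).
             if a < r then (if c = 0 then F (P + a) j else U $$ (a, c - 1))
             else (if c = 0 then F i j else F i (Q + (c - 1))))"
      unfolding N_def U_def by (rule eq_matI) auto
    ultimately have "(- 1) ^ r * (F i j - (\<Sum>b<r. \<Sum>a<r. F i (Q + b) * adj_mat U $$ (b, a) * F (P + a) j)) \<in> J"
      using det_bordered[OF U adj_mat(1)[OF U] UV, of "\<lambda>a. F (P + a) j" "F i j" "\<lambda>b. F i (Q + b)"] det
      unfolding U_def by simp
    then have "F i j - (\<Sum>b<r. \<Sum>a<r. F i (Q + b) * adj_mat U $$ (b, a) * F (P + a) j) \<in> J"
      using J_uminus by (cases "even r") force+
    also have "(\<Sum>b<r. \<Sum>a<r. F i (Q + b) * adj_mat U $$ (b, a) * F (P + a) j)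
        = (\<Sum>b<r. \<Sum>a<r. F i (Q + b) * V b a * F (P + a) j)"
      unfolding V_def by simp
    finally show ?thesis .
  qed
  ultimately show ?thesis using that by blast
qed

end

section \<open>Minors of \<open>zmat n\<close> and the ideals they generate\<close>

text \<open>\<open>minor\<close> chooses its 0-based indices through \<open>pick\<close>, while the
  computations need explicit rows and columns. The two agree because exactly \<open>a\<close> chosen
  indices lie below \<open>h a - 1\<close> when \<open>h\<close> is strictly increasing.\<close>

lemma minor_enum:
  assumes e: "strict_mono_on {..<m} e" "e ` {..<m} \<subseteq> {1..n}"
    and g: "strict_mono_on {..<m} g" "g ` {..<m} \<subseteq> {1..n}"
  shows "minor n (e ` {..<m}) (g ` {..<m}) = det (mat m m (\<lambda>(a, b). zmat n $$ (e a - 1, g b - 1)))"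
proof -
  have enum: "card {i. i < n \<and> i + 1 \<in> h ` {..<m}} = m \<and>
      (\<forall>a<m. pick {i. i + 1 \<in> h ` {..<m}} a = h a - 1)"
    if h: "strict_mono_on {..<m} h" "h ` {..<m} \<subseteq> {1..n}" for h
  proof -
    have pos: "1 \<le> h a \<and> h a \<le> n" if "a < m" for a using h(2) that by force
    have less: "h a < h b \<longleftrightarrow> a < b" if "a < m" "b < m" for a b
      using strict_mono_on_less[OF h(1)] that by auto
    have inj: "inj_on (\<lambda>a. h a - 1) X" if "X \<subseteq> {..<m}" for X
    proof (rule inj_onI)
      fix a b assume "a \<in> X" "b \<in> X" and eq: "h a - 1 = h b - 1"
      then have ab: "a < m" "b < m" using that by auto
      then show "a = b" using less[OF ab] less[OF ab(2,1)] pos[of a] pos[of b] eq by auto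
    qed
    have "{i. i < n \<and> i + 1 \<in> h ` {..<m}} = (\<lambda>a. h a - 1) ` {..<m}"
    proof (intro Set.set_eqI iffI)
      fix i assume "i \<in> {i. i < n \<and> i + 1 \<in> h ` {..<m}}"
      then obtain a where "a < m" "i + 1 = h a" by blast
      then show "i \<in> (\<lambda>a. h a - 1) ` {..<m}" by (intro image_eqI[of _ _ a]) auto
    next
      fix i assume "i \<in> (\<lambda>a. h a - 1) ` {..<m}"
      then obtain a where a: "a < m" "i = h a - 1" by blast
      then have "i + 1 = h a" "i < n" using pos[of a] by auto
      then show "i \<in> {i. i < n \<and> i + 1 \<in> h ` {..<m}}" using a(1) by blast
    qed
    then have "card {i. i < n \<and> i + 1 \<in> h ` {..<m}} = m"
      using card_image[OF inj[OF subset_refl]] by simp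
    moreover have "pick {i. i + 1 \<in> h ` {..<m}} a = h a - 1" if a: "a < m" for a
    proof -
      let ?I = "{i. i + 1 \<in> h ` {..<m}}"
      have "{i \<in> ?I. i < h a - 1} = (\<lambda>a. h a - 1) ` {..<a}"
      proof (intro Set.set_eqI iffI)
        fix i assume i: "i \<in> {i \<in> ?I. i < h a - 1}"
        then obtain b where b: "b < m" "i + 1 = h b" by blast
        then have "b < a" using less[OF b(1) a] i by auto
        then show "i \<in> (\<lambda>a. h a - 1) ` {..<a}" using b by (intro image_eqI[of _ _ b]) auto
      next
        fix i assume "i \<in> (\<lambda>a. h a - 1) ` {..<a}"
        then obtain b where b: "b < a" "i = h b - 1" by blast
        then have "i + 1 = h b" "i < h a - 1" using less[of b a] a pos[of b] by auto
        then show "i \<in> {i \<in> ?I. i < h a - 1}" using b a by auto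
      qed
      then have "card {i \<in> ?I. i < h a - 1} = a"
        using card_image[OF inj[of "{..<a}"]] a by simp
      moreover have "h a - 1 \<in> ?I" using pos[OF a] a by auto
      ultimately show ?thesis using pick_card_in_set[of "h a - 1" ?I] by simp
    qed
    ultimately show ?thesis by blast
  qed
  show ?thesis
    unfolding minor_def submatrix_def using enum[OF e] enum[OF g]
    by (intro arg_cong[of _ _ det] eq_matI) (auto simp: zmat_def)
qed

lemma minor_enumE:
  assumes "A \<subseteq> {1..n}" "B \<subseteq> {1..n}" "card A = m" "card B = m"
  obtains e g where "\<And>a. a < m \<Longrightarrow> e a \<in> A" "\<And>b. b < m \<Longrightarrow> g b \<in> B"
    "minor n A B = det (mat m m (\<lambda>(a, b). zmat n $$ (e a - 1, g b - 1)))"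
proof -
  have "finite A" "finite B" using assms finite_subset by blast+
  then obtain e g where "bij_betw e {..<m} A" "strict_mono_on {..<m} e"
      "bij_betw g {..<m} B" "strict_mono_on {..<m} g"
    using ex_bij_betw_strict_mono_card[of A] ex_bij_betw_strict_mono_card[of B] assms by metis
  then show ?thesis
    using minor_enum[of m e n g] that[of e g] assms by (auto simp: bij_betw_def)
qed

lemma zring_simps [simp]:
  "\<zero>\<^bsub>zring n\<^esub> = 0" "\<one>\<^bsub>zring n\<^esub> = 1" "a \<oplus>\<^bsub>zring n\<^esub> b = a + b" "a \<otimes>\<^bsub>zring n\<^esub> b = a * b"
  by (simp_all add: zring_def)

lemma subring_ideal_zring:
  assumes "ideal J (zring n)"
  shows "subring_ideal (carrier (zring n)) J"
proof -
  interpret cring "zring n" by (rule cring_zring)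
  interpret ideal J "zring n" by (rule assms)
  show ?thesis
  proof
    show "1 \<in> carrier (zring n)" "0 \<in> carrier (zring n)" "0 \<in> J"
      using one_closed zero_closed additive_subgroup.zero_closed[OF is_additive_subgroup] by simp_all
    fix a b assume "a \<in> carrier (zring n)" "b \<in> carrier (zring n)"
    then show "a + b \<in> carrier (zring n)" "a * b \<in> carrier (zring n)"
      using add.m_closed m_closed by simp_all
  next
    fix a assume "a \<in> carrier (zring n)"
    then show "- a \<in> carrier (zring n)" by (simp add: zring_def)
  next
    fix x y assume "x \<in> J" "y \<in> J"
    then show "x + y \<in> J" using additive_subgroup.a_closed[OF is_additive_subgroup] by simp
  next
    fix a x assume "a \<in> carrier (zring n)" "x \<in> J"
    then show "a * x \<in> J" using I_l_closed[of x a] by simp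
  qed
qed

lemma zmat_entry_in_zring:
  assumes "i < n" "j < n"
  shows "zmat n $$ (i, j) \<in> carrier (zring n)"
  using assms by (auto simp: zmat_def zring_def zvar_def)

lemma minor_in_zring:
  assumes "A \<subseteq> {1..n}" "B \<subseteq> {1..n}" "card A = card B"
  shows "minor n A B \<in> carrier (zring n)"
proof -
  \<comment> \<open>Closure under determinants concerns the ring alone, so the whole ring serves as
    the ideal of the locale.\<close>
  interpret subring_ideal "carrier (zring n)" "carrier (zring n)"
    by (rule subring_ideal_zring) (rule ring.oneideal[OF cring.axioms(1)[OF cring_zring]])
  obtain e g where eg: "\<And>a. a < card B \<Longrightarrow> e a \<in> A" "\<And>b. b < card B \<Longrightarrow> g b \<in> B"
    "minor n A B = det (mat (card B) (card B) (\<lambda>(a, b). zmat n $$ (e a - 1, g b - 1)))"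
    using minor_enumE[OF assms(1,2,3) refl] by blast
  have "e a - 1 < n" "g a - 1 < n" if "a < card B" for a
    using eg(1)[OF that] eg(2)[OF that] assms by force+
  then show ?thesis unfolding eg(3) by (intro det_in_S) (auto intro!: zmat_entry_in_zring)
qed

text \<open>Both facts rest on the generators lying in the carrier; the bounds on \<open>p\<close>
  and \<open>q\<close> keep all their indices in \<open>{1..n}\<close>.\<close>

lemma rank_ideal_ideal:
  assumes "1 \<le> p" "q \<le> n"
  shows "ideal (rank_ideal n p q r) (zring n)"
    and "A \<subseteq> {p..n} \<Longrightarrow> B \<subseteq> {1..q} \<Longrightarrow> card A = r + 1 \<Longrightarrow> card B = r + 1 \<Longrightarrow>
      minor n A B \<in> rank_ideal n p q r"
proof -
  interpret cring "zring n" by (rule cring_zring)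
  let ?G = "{minor n A B | A B. A \<subseteq> {p..n} \<and> B \<subseteq> {1..q} \<and> card A = r + 1 \<and> card B = r + 1}"
  have G: "?G \<subseteq> carrier (zring n)"
  proof clarify
    fix A B assume "A \<subseteq> {p..n}" "B \<subseteq> {1..q}" "card A = r + 1" "card B = r + 1"
    moreover have "{p..n} \<subseteq> {1..n}" "{1..q} \<subseteq> {1..n}" using assms by auto
    ultimately show "minor n A B \<in> carrier (zring n)" by (intro minor_in_zring) auto
  qed
  show "ideal (rank_ideal n p q r) (zring n)" unfolding rank_ideal_def by (rule genideal_ideal[OF G])
  show "minor n A B \<in> rank_ideal n p q r"
    if "A \<subseteq> {p..n}" "B \<subseteq> {1..q}" "card A = r + 1" "card B = r + 1"
    unfolding rank_ideal_def using that genideal_self[OF G] by blast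
qed

lemma perm_ideal_ideal:
  shows "ideal (perm_ideal n v) (zring n)"
    and "(p, q) \<in> essential_set n v \<Longrightarrow> rank_ideal n p q (rk v p q) \<subseteq> perm_ideal n v"
proof -
  interpret cring "zring n" by (rule cring_zring)
  let ?G = "\<Union>(p, q) \<in> essential_set n v. rank_ideal n p q (rk v p q)"
  have G: "?G \<subseteq> carrier (zring n)"
  proof clarify
    fix p q x assume "(p, q) \<in> essential_set n v" and x: "x \<in> rank_ideal n p q (rk v p q)"
    then have "1 \<le> p" "q \<le> n" unfolding essential_set_def diagram_def by auto
    then show "x \<in> carrier (zring n)" using ideal.Icarr[OF rank_ideal_ideal(1)] x by blast
  qed
  show "ideal (perm_ideal n v) (zring n)" unfolding perm_ideal_def by (rule genideal_ideal[OF G])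
  show "rank_ideal n p q (rk v p q) \<subseteq> perm_ideal n v" if "(p, q) \<in> essential_set n v"
    unfolding perm_ideal_def using genideal_self[OF G] that by blast
qed

lemma minor_interval:
  assumes "1 \<le> P" "1 \<le> Q" "P + r \<le> n" "Q + r \<le> n"
  shows "minor n {P..P + r} {Q..Q + r} = det (mat (Suc r) (Suc r) (\<lambda>(a, b). zmat n $$ (P + a - 1, Q + b - 1)))"
proof -
  have im: "(+) x ` {..<Suc r} = {x..x + r}" for x :: nat
    by (simp add: lessThan_atLeast0 image_add_atLeastLessThan atLeastLessThanSuc_atLeastAtMost)
  show ?thesis
    using minor_enum[of "Suc r" "(+) P" n "(+) Q"] assms unfolding im
    by (auto simp: strict_mono_on_def)
qed

section \<open>Reduction of columns and rows modulo I_v\<close>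

text \<open>The last fact splits the inclusion condition by the term attaining the minimum. Either
  the pivot block is empty, or its first column \<open>q - r + 1\<close> equals its first row
  \<open>p\<close>, where \<open>r\<close> is the rank.\<close>

lemma dbi_rk:
  assumes "w permutes {1..n}" "associated_dbi n w v"
    and E: "(p, q) \<in> essential_set n w - exceptional_set n w"
  shows "(p, q) \<in> essential_set n v" "rk v p q = rk w p q" "rk w p q \<le> q" "p \<in> {1..n}" "q \<in> {1..n}"
    "rk w p q = 0 \<or> p + rk w p q = q + 1"
proof -
  show Ev: "(p, q) \<in> essential_set n v" and rk: "rk v p q = rk w p q"
    using assms unfolding associated_dbi_def by auto
  show pq: "p \<in> {1..n}" "q \<in> {1..n}" using E unfolding essential_set_def diagram_def by auto
  have "rk w p q \<le> card {1..q}" unfolding rk_def by (rule card_mono) auto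
  then show "rk w p q \<le> q" by simp
  have "int q - int (rk w p q) = min (int p - 1) (int q)"
    using associated_dbi_defined_by_inclusions[OF assms(1,2)] Ev rk
    unfolding defined_by_inclusions_def by fastforce
  then show "rk w p q = 0 \<or> p + rk w p q = q + 1" by linarith
qed

text \<open>The pivot block is empty if A holds at \<open>(p, q)\<close>; if B holds, it lies on the diagonal of \<open>M\<close>.
  Either way its determinant is 1, so the Schur complement needs no division.\<close>

lemma essential_pivot_block:
  assumes J: "ideal J (zring n)" "perm_ideal n v \<subseteq> J"
    and E: "(p, q) \<in> essential_set n v" and r: "r = rk v p q" "r \<le> q" "r = 0 \<or> p + r = q + 1"
  obtains V where "\<And>b a. V b a \<in> carrier (zring n)"
    "\<And>i j. p \<le> i \<Longrightarrow> i \<le> n \<Longrightarrow> 1 \<le> j \<Longrightarrow> j \<le> q \<Longrightarrow>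
      zmat n $$ (i - 1, j - 1) - (\<Sum>b<r. \<Sum>a<r. zmat n $$ (i - 1, q - r + b) * V b a * zmat n $$ (p + a - 1, j - 1)) \<in> J"
proof -
  interpret subring_ideal "carrier (zring n)" J by (rule subring_ideal_zring[OF J(1)])
  \<comment> \<open>Shifted to 1-based indices and extended by 0, so that every value lies in the
    ring.\<close>
  define F where "F i j = (if i - 1 < n \<and> j - 1 < n then zmat n $$ (i - 1, j - 1) else 0)" for i j
  have pq: "p \<in> {1..n}" "q \<in> {1..n}" using E unfolding essential_set_def diagram_def by auto
  define Q where "Q = q - r + 1"
  have Q: "Q + r = q + 1" "1 \<le> Q" using r unfolding Q_def by auto
  have F: "F i j \<in> carrier (zring n)" for i j unfolding F_def by (auto intro: zmat_entry_in_zring S_zero)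
  have det: "det (mat r r (\<lambda>(a, b). F (p + a) (Q + b))) = 1"
  proof -
    let ?U = "mat r r (\<lambda>(a, b). F (p + a) (Q + b))"
    have Qp: "Q = p" if "a < r" for a using r that Q by auto
    have "det ?U = prod_list (diag_mat ?U)"
    proof (rule det_lower_triangular)
      show "?U $$ (i, j) = 0" if "i < j" "j < r" for i j
        using that Qp[of j] pq by (auto simp: F_def zmat_def)
    qed simp
    also have "diag_mat ?U = map (\<lambda>_. 1) [0..<r]"
      unfolding diag_mat_def using Qp pq Q by (intro map_cong) (auto simp: F_def zmat_def)
    also have "prod_list \<dots> = (1 :: zpoly)" by (induction r) simp_all
    finally show ?thesis .
  qed
  have minors: "det (mat (Suc r) (Suc r) (\<lambda>(a, c). F (if a < r then p + a else i) (if c = 0 then j else Q + (c - 1)))) \<in> J"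
    if ij: "p + r \<le> i" "i \<le> n" "1 \<le> j" "j < Q" for i j
  proof -
    let ?e = "\<lambda>a. if a < r then p + a else i" and ?g = "\<lambda>c. if c = 0 then j else Q + (c - 1)"
    let ?A = "?e ` {..<Suc r}" and ?B = "?g ` {..<Suc r}"
    have mono: "strict_mono_on {..<Suc r} ?e" "strict_mono_on {..<Suc r} ?g"
      using ij by (auto simp: strict_mono_on_def)
    have sub: "?A \<subseteq> {p..n}" "?B \<subseteq> {1..q}" using ij Q by auto
    moreover have "{p..n} \<subseteq> {1..n}" "{1..q} \<subseteq> {1..n}" using pq by auto
    ultimately have sub': "?A \<subseteq> {1..n}" "?B \<subseteq> {1..n}" by blast+
    \<comment> \<open>The bordering row and column stay within rows \<open>{p..n}\<close> and
      columns \<open>{1..q}\<close>, so this minor is one of the generators of size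
      \<open>r + 1\<close>.\<close>
    have "minor n ?A ?B \<in> rank_ideal n p q r"
    proof (rule rank_ideal_ideal(2))
      show "card ?A = r + 1" "card ?B = r + 1"
        using card_image[OF strict_mono_on_imp_inj_on[OF mono(1)]]
          card_image[OF strict_mono_on_imp_inj_on[OF mono(2)]] by simp_all
    qed (use sub pq in auto)
    then have "minor n ?A ?B \<in> J" using perm_ideal_ideal(2)[OF E] J(2) r(1) by blast
    also have "minor n ?A ?B = det (mat (Suc r) (Suc r) (\<lambda>(a, b). zmat n $$ (?e a - 1, ?g b - 1)))"
      by (rule minor_enum[OF mono(1) sub'(1) mono(2) sub'(2)])
    also have "mat (Suc r) (Suc r) (\<lambda>(a, b). zmat n $$ (?e a - 1, ?g b - 1))
        = mat (Suc r) (Suc r) (\<lambda>(a, c). F (?e a) (?g c))"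
    proof (rule eq_matI)
      fix a b assume "a < dim_row (mat (Suc r) (Suc r) (\<lambda>(a, c). F (?e a) (?g c)))"
        "b < dim_col (mat (Suc r) (Suc r) (\<lambda>(a, c). F (?e a) (?g c)))"
      then have ab: "a < Suc r" "b < Suc r" by simp_all
      then have "?e a \<in> {1..n}" "?g b \<in> {1..n}" using sub' by blast+
      then have "?e a - 1 < n" "?g b - 1 < n" by auto
      then have "F (?e a) (?g b) = zmat n $$ (?e a - 1, ?g b - 1)" unfolding F_def by simp
      then show "mat (Suc r) (Suc r) (\<lambda>(a, b). zmat n $$ (?e a - 1, ?g b - 1)) $$ (a, b)
          = mat (Suc r) (Suc r) (\<lambda>(a, c). F (?e a) (?g c)) $$ (a, b)"
        using ab by simp
    qed simp_all
    finally show ?thesis .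
  qed
  obtain V where V: "\<And>b a. V b a \<in> carrier (zring n)"
    "\<And>i j. p \<le> i \<Longrightarrow> i \<le> n \<Longrightarrow> 1 \<le> j \<Longrightarrow> j < Q + r \<Longrightarrow>
       F i j - (\<Sum>b<r. \<Sum>a<r. F i (Q + b) * V b a * F (p + a) j) \<in> J"
    using schur_complement_J[of F r p Q n, OF F det minors] by blast
  show ?thesis
  proof (rule that[of V])
    fix i j assume ij: "p \<le> i" "i \<le> n" "1 \<le> j" "j \<le> q"
    have "F i j = zmat n $$ (i - 1, j - 1)" using ij pq unfolding F_def by auto
    moreover have "F i (Q + b) = zmat n $$ (i - 1, q - r + b)" "F (p + a) j = zmat n $$ (p + a - 1, j - 1)"
      if "a < r" "b < r" for a b
      using ij pq that r Q unfolding F_def Q_def by auto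
    then have "(\<Sum>b<r. \<Sum>a<r. F i (Q + b) * V b a * F (p + a) j)
        = (\<Sum>b<r. \<Sum>a<r. zmat n $$ (i - 1, q - r + b) * V b a * zmat n $$ (p + a - 1, j - 1))"
      by (intro sum.cong) auto
    ultimately show "zmat n $$ (i - 1, j - 1)
        - (\<Sum>b<r. \<Sum>a<r. zmat n $$ (i - 1, q - r + b) * V b a * zmat n $$ (p + a - 1, j - 1)) \<in> J"
      using V(2)[of i j] ij Q by simp
  qed (rule V(1))
qed

text \<open>Columns after \<open>q'\<close> are already among the last \<open>r + 1\<close>; those
  up to \<open>q'\<close> come from the Schur complement at the pivot. The pivot equation puts the
  first column of the block at \<open>q - r\<close>, so its columns are the first \<open>r'\<close>
  of the last \<open>r + 1\<close>.\<close>

lemma column_reduction: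
  assumes w: "w permutes {1..n}" "almost_defined_by_inclusions n w" "associated_dbi n w v"
    and ex: "(p, q) \<in> exceptional_set n w"
    and J: "ideal J (zring n)" "perm_ideal n v \<subseteq> J" and r: "r = rk w p q"
  obtains C where "r < q" "\<And>k j. 1 \<le> j \<Longrightarrow> j \<le> q \<Longrightarrow> C k j \<in> carrier (zring n)"
    "\<And>i j. p \<le> i \<Longrightarrow> i \<le> n \<Longrightarrow> 1 \<le> j \<Longrightarrow> j \<le> q \<Longrightarrow>
      zmat n $$ (i - 1, j - 1) - (\<Sum>k<Suc r. zmat n $$ (i - 1, q - r + k - 1) * C k j) \<in> J"
proof -
  interpret subring_ideal "carrier (zring n)" J by (rule subring_ideal_zring[OF J(1)])
  have pq: "p \<in> {1..n}" "q \<in> {1..n}" using ex unfolding exceptional_set_def essential_set_def diagram_def by auto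
  have delta: "zmat n $$ (i - 1, j - 1)
      - (\<Sum>k<Suc r. zmat n $$ (i - 1, q - r + k - 1) * (if j = q - r + k then 1 else 0)) \<in> J"
    if "q - r \<le> j" "j \<le> q" "r < q" for i j
  proof -
    have "(\<Sum>k<Suc r. zmat n $$ (i - 1, q - r + k - 1) * (if j = q - r + k then 1 else 0))
        = (\<Sum>k<Suc r. if k = j - (q - r) then zmat n $$ (i - 1, j - 1) else 0)"
      using that by (intro sum.cong) auto
    also have "\<dots> = zmat n $$ (i - 1, j - 1)"
      using that by (subst sum.delta) auto
    finally show ?thesis using J_zero by (simp del: sum.lessThan_Suc)
  qed
  consider "q = r + 1"
    | p' q' where "(p', q') \<in> essential_set n w - exceptional_set n w" "p' \<le> p" "q' \<le> q"
        "q' + r + 1 = q + rk w p' q'"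
    using column_pivot[OF w(1,2) ex] r by blast
  then show ?thesis
  proof cases
    case 1
    show ?thesis
      by (rule that[of "\<lambda>k j. if j = q - r + k then 1 else 0"]) (use 1 delta S_zero S_one in \<open>auto simp del: sum.lessThan_Suc\<close>)
  next
    case 2
    define r' where "r' = rk w p' q'"
    note dbi = dbi_rk[OF w(1,3) 2(1), folded r'_def]
    have eq: "q' + r + 1 = q + r'" using 2(4) unfolding r'_def .
    \<comment> \<open>\<open>base\<close> aligns the indices: the 0-based column
      \<open>q - r + k - 1\<close> is column \<open>q' - r' + k\<close> of the Schur
      formula.\<close>
    have rq: "r < q" and r'r: "r' \<le> r + 1" and base: "q - r = q' - r' + 1" using eq dbi(3) 2(3) by auto
    obtain V where V: "\<And>b a. V b a \<in> carrier (zring n)"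
      "\<And>i j. p' \<le> i \<Longrightarrow> i \<le> n \<Longrightarrow> 1 \<le> j \<Longrightarrow> j \<le> q' \<Longrightarrow>
        zmat n $$ (i - 1, j - 1) - (\<Sum>b<r'. \<Sum>a<r'. zmat n $$ (i - 1, q' - r' + b) * V b a * zmat n $$ (p' + a - 1, j - 1)) \<in> J"
      using essential_pivot_block[OF J dbi(1) dbi(2)[symmetric] dbi(3,6)] by blast
    \<comment> \<open>The Schur coefficients fill the first \<open>r'\<close> places and are padded
      by 0; a column beyond \<open>q'\<close> represents itself.\<close>
    define C where "C k j = (if j \<le> q' then if k < r' then \<Sum>a<r'. V k a * zmat n $$ (p' + a - 1, j - 1) else 0
        else if j = q - r + k then 1 else 0)" for k j
    show ?thesis
    proof (rule that[of C, OF rq])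
      fix k j assume "1 \<le> j" "j \<le> q"
      moreover have "p' + a - 1 < n" if "a < r'" for a using dbi that by auto
      ultimately show "C k j \<in> carrier (zring n)"
        using dbi(5) unfolding C_def by (auto intro!: S_zero S_one S_sum S_mult V(1) zmat_entry_in_zring)
    next
      fix i j assume ij: "p \<le> i" "i \<le> n" "1 \<le> j" "j \<le> q"
      show "zmat n $$ (i - 1, j - 1) - (\<Sum>k<Suc r. zmat n $$ (i - 1, q - r + k - 1) * C k j) \<in> J"
      proof (cases "j \<le> q'")
        case True
        have "(\<Sum>k<Suc r. zmat n $$ (i - 1, q - r + k - 1) * C k j)
            = (\<Sum>k<r'. zmat n $$ (i - 1, q - r + k - 1) * C k j)"
          using r'r True by (intro sum.mono_neutral_right) (auto simp: C_def)
        also have "\<dots> = (\<Sum>b<r'. \<Sum>a<r'. zmat n $$ (i - 1, q' - r' + b) * V b a * zmat n $$ (p' + a - 1, j - 1))"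
          using True base by (intro sum.cong) (auto simp: C_def sum_distrib_left mult.assoc)
        finally show ?thesis using V(2)[of i j] ij 2(2) True by simp
      next
        case False
        then have "C k j = (if j = q - r + k then 1 else 0)" for k unfolding C_def by simp
        then show ?thesis using delta[of j i] False ij base rq by simp
      qed
    qed
  qed
qed

text \<open>Dual to \<open>column_reduction\<close>: rows above \<open>p'\<close> are already among
  \<open>{p..p + r}\<close>, and the remaining ones come from the Schur complement. By the pivot
  equation the block ends at row \<open>p + r\<close>, so its rows are the last \<open>r'\<close> of
  these.\<close>

lemma row_reduction:
  assumes w: "w permutes {1..n}" "almost_defined_by_inclusions n w" "associated_dbi n w v"
    and ex: "(p, q) \<in> exceptional_set n w"
    and J: "ideal J (zring n)" "perm_ideal n v \<subseteq> J" and r: "r = rk w p q"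
  obtains L where "p + r \<le> n" "\<And>i l. p \<le> i \<Longrightarrow> i \<le> n \<Longrightarrow> L i l \<in> carrier (zring n)"
    "\<And>i j. p \<le> i \<Longrightarrow> i \<le> n \<Longrightarrow> 1 \<le> j \<Longrightarrow> j \<le> q \<Longrightarrow>
      zmat n $$ (i - 1, j - 1) - (\<Sum>l<Suc r. L i l * zmat n $$ (p + l - 1, j - 1)) \<in> J"
proof -
  interpret subring_ideal "carrier (zring n)" J by (rule subring_ideal_zring[OF J(1)])
  have pq: "p \<in> {1..n}" "q \<in> {1..n}" using ex unfolding exceptional_set_def essential_set_def diagram_def by auto
  have delta: "zmat n $$ (i - 1, j - 1)
      - (\<Sum>l<Suc r. (if i = p + l then 1 else 0) * zmat n $$ (p + l - 1, j - 1)) \<in> J"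
    if "p \<le> i" "i \<le> p + r" for i j
  proof -
    have "(\<Sum>l<Suc r. (if i = p + l then 1 else 0) * zmat n $$ (p + l - 1, j - 1))
        = (\<Sum>l<Suc r. if l = i - p then zmat n $$ (i - 1, j - 1) else 0)"
      using that by (intro sum.cong) auto
    also have "\<dots> = zmat n $$ (i - 1, j - 1)"
      using that by (subst sum.delta) auto
    finally show ?thesis using J_zero by (simp del: sum.lessThan_Suc)
  qed
  consider "p + r = n"
    | p' q' where "(p', q') \<in> essential_set n w - exceptional_set n w" "p \<le> p'" "q \<le> q'"
        "p' + rk w p' q' = p + r + 1"
    using row_pivot[OF w(1,2) ex] r by blast
  then show ?thesis
  proof cases
    case 1
    show ?thesis
      by (rule that[of "\<lambda>i l. if i = p + l then 1 else 0"]) (use 1 delta S_zero S_one in \<open>auto simp del: sum.lessThan_Suc\<close>)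
  next
    case 2
    define r' where "r' = rk w p' q'"
    note dbi = dbi_rk[OF w(1,3) 2(1), folded r'_def]
    have eq: "p' + r' = p + r + 1" using 2(4) unfolding r'_def .
    \<comment> \<open>Offset of the block among the chosen rows: block row \<open>a\<close> is
      chosen row \<open>d + a\<close>.\<close>
    define d where "d = p' - p"
    \<comment> \<open>An empty block gives \<open>p + r + 1 = p'\<close>; a nonempty one lies on the
      diagonal, so that \<open>p + r = q'\<close>. Both \<open>p'\<close> and \<open>q'\<close> are
      at most \<open>n\<close>.\<close>
    have rn: "p + r \<le> n" and d: "Suc r = d + r'" "p' = p + d" using eq dbi(4-6) 2(2) unfolding d_def by auto
    obtain V where V: "\<And>b a. V b a \<in> carrier (zring n)"
      "\<And>i j. p' \<le> i \<Longrightarrow> i \<le> n \<Longrightarrow> 1 \<le> j \<Longrightarrow> j \<le> q' \<Longrightarrow>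
        zmat n $$ (i - 1, j - 1) - (\<Sum>b<r'. \<Sum>a<r'. zmat n $$ (i - 1, q' - r' + b) * V b a * zmat n $$ (p' + a - 1, j - 1)) \<in> J"
      using essential_pivot_block[OF J dbi(1) dbi(2)[symmetric] dbi(3,6)] by blast
    define L where "L i l = (if p' \<le> i then if d \<le> l then \<Sum>b<r'. zmat n $$ (i - 1, q' - r' + b) * V b (l - d) else 0
        else if i = p + l then 1 else 0)" for i l
    show ?thesis
    proof (rule that[of L, OF rn])
      fix i l assume "p \<le> i" "i \<le> n"
      moreover have "q' - r' + b < n" if "b < r'" for b using dbi(3,5) that by auto
      ultimately show "L i l \<in> carrier (zring n)"
        using pq unfolding L_def by (auto intro!: S_zero S_one S_sum S_mult V(1) zmat_entry_in_zring)
    next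
      fix i j assume ij: "p \<le> i" "i \<le> n" "1 \<le> j" "j \<le> q"
      show "zmat n $$ (i - 1, j - 1) - (\<Sum>l<Suc r. L i l * zmat n $$ (p + l - 1, j - 1)) \<in> J"
      proof (cases "p' \<le> i")
        case True
        have "(\<Sum>l<Suc r. L i l * zmat n $$ (p + l - 1, j - 1))
            = (\<Sum>l\<in>{d..<d + r'}. L i l * zmat n $$ (p + l - 1, j - 1))"
          using d True by (intro sum.mono_neutral_right) (auto simp: L_def)
        also have "\<dots> = (\<Sum>a<r'. L i (d + a) * zmat n $$ (p' + a - 1, j - 1))"
          using sum.shift_bounds_nat_ivl[of "\<lambda>l. L i l * zmat n $$ (p + l - 1, j - 1)" 0 d r']
          by (simp add: d(2) lessThan_atLeast0 add_ac)
        also have "\<dots> = (\<Sum>a<r'. \<Sum>b<r'. zmat n $$ (i - 1, q' - r' + b) * V b a * zmat n $$ (p' + a - 1, j - 1))"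
          using True by (intro sum.cong) (auto simp: L_def sum_distrib_right)
        also have "\<dots> = (\<Sum>b<r'. \<Sum>a<r'. zmat n $$ (i - 1, q' - r' + b) * V b a * zmat n $$ (p' + a - 1, j - 1))"
          by (rule sum.swap)
        finally show ?thesis using V(2)[of i j] ij 2(3) True by simp
      next
        case False
        then have "L i l = (if i = p + l then 1 else 0)" for l unfolding L_def by simp
        then show ?thesis using delta[of i j] False ij d by simp
      qed
    qed
  qed
qed

section \<open>Factorization of the minors modulo the sum ideal\<close>

theorem lemma4p6:
  fixes n :: nat and w v :: "nat \<Rightarrow> nat" and p q :: nat
  assumes "w permutes {1..n}"
    and "almost_defined_by_inclusions n w"
    and "associated_dbi n w v"
    and "(p, q) \<in> exceptional_set n w"
  shows "rank_ideal n p q (rk w p q)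
           \<subseteq> perm_ideal n v <+>\<^bsub>zring n\<^esub> (Idl\<^bsub>zring n\<^esub> {fpoly n w p q})"
proof -
  interpret cring "zring n" by (rule cring_zring)
  define r where "r = rk w p q"
  define J where "J = perm_ideal n v <+>\<^bsub>zring n\<^esub> (Idl\<^bsub>zring n\<^esub> {fpoly n w p q})"
  have pq: "p \<in> {1..n}" "q \<in> {1..n}"
    using assms(4) unfolding exceptional_set_def essential_set_def diagram_def by auto
  note perm = perm_ideal_ideal(1)[of n v]
  \<comment> \<open>The bounds are needed to see that \<open>fpoly n w p q\<close> lies in the ring,
    and hence that \<open>J\<close> is an ideal. So the reductions are applied first with I_v itself
    in place of \<open>J\<close>.\<close>
  have rq: "r < q" by (rule column_reduction[OF assms perm subset_refl r_def])
  have rn: "p + r \<le> n" by (rule row_reduction[OF assms perm subset_refl r_def])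
  have f_eq: "fpoly n w p q = minor n {p..p + r} {q - r..q}" unfolding fpoly_def r_def ..
  have f: "fpoly n w p q \<in> carrier (zring n)"
    unfolding f_eq using rq rn pq by (intro minor_in_zring) auto
  then have idl: "ideal (Idl\<^bsub>zring n\<^esub> {fpoly n w p q}) (zring n)" by (intro genideal_ideal) simp
  have JI: "ideal J (zring n)" unfolding J_def by (rule add_ideals[OF perm idl])
  have zero: "0 \<in> perm_ideal n v" "0 \<in> Idl\<^bsub>zring n\<^esub> {fpoly n w p q}"
    using additive_subgroup.zero_closed[OF ideal.axioms(1)] perm idl by force+
  have fJ: "fpoly n w p q \<in> J"
    using zero(1) genideal_self'[OF f] unfolding J_def set_add_def' by force
  have pJ: "perm_ideal n v \<subseteq> J"
    using zero(2) unfolding J_def set_add_def' by force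
  interpret subring_ideal "carrier (zring n)" J by (rule subring_ideal_zring[OF JI])
  obtain C where C: "\<And>k j. 1 \<le> j \<Longrightarrow> j \<le> q \<Longrightarrow> C k j \<in> carrier (zring n)"
    "\<And>i j. p \<le> i \<Longrightarrow> i \<le> n \<Longrightarrow> 1 \<le> j \<Longrightarrow> j \<le> q \<Longrightarrow>
      zmat n $$ (i - 1, j - 1) - (\<Sum>k<Suc r. zmat n $$ (i - 1, q - r + k - 1) * C k j) \<in> J"
    by (rule column_reduction[OF assms JI pJ r_def]) blast
  obtain L where L: "\<And>i l. p \<le> i \<Longrightarrow> i \<le> n \<Longrightarrow> L i l \<in> carrier (zring n)"
    "\<And>i j. p \<le> i \<Longrightarrow> i \<le> n \<Longrightarrow> 1 \<le> j \<Longrightarrow> j \<le> q \<Longrightarrow>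
      zmat n $$ (i - 1, j - 1) - (\<Sum>l<Suc r. L i l * zmat n $$ (p + l - 1, j - 1)) \<in> J"
    by (rule row_reduction[OF assms JI pJ r_def]) blast
  have "minor n A B \<in> J"
    if AB: "A \<subseteq> {p..n}" "B \<subseteq> {1..q}" "card A = r + 1" "card B = r + 1" for A B
  proof -
    have "A \<subseteq> {1..n}" "B \<subseteq> {1..n}" "card A = Suc r" "card B = Suc r" using AB pq by force+
    then obtain e g where eg: "\<And>a. a < Suc r \<Longrightarrow> e a \<in> A" "\<And>b. b < Suc r \<Longrightarrow> g b \<in> B"
      "minor n A B = det (mat (Suc r) (Suc r) (\<lambda>(a, b). zmat n $$ (e a - 1, g b - 1)))"
      using minor_enumE[of A n B "Suc r"] by blast
    have e: "p \<le> e a" "e a \<le> n" if "a < Suc r" for a using eg(1)[OF that] AB by auto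
    have g: "1 \<le> g b" "g b \<le> q" if "b < Suc r" for b using eg(2)[OF that] AB by auto
    define X where "X = mat (Suc r) (Suc r) (\<lambda>(a, b). zmat n $$ (e a - 1, g b - 1))"
    define L' where "L' = mat (Suc r) (Suc r) (\<lambda>(a, l). L (e a) l)"
    \<comment> \<open>Rows \<open>{p..p + r}\<close> and columns \<open>{q - r..q}\<close>, so that
      its determinant is \<open>fpoly n w p q\<close>; \<open>L'\<close> and \<open>C'\<close> hold
      the coefficients of the two reductions.\<close>
    define F where "F = mat (Suc r) (Suc r) (\<lambda>(l, k). zmat n $$ (p + l - 1, q - r + k - 1))"
    define C' where "C' = mat (Suc r) (Suc r) (\<lambda>(k, b). C k (g b))"
    have carr: "X \<in> carrier_mat (Suc r) (Suc r)" "L' \<in> carrier_mat (Suc r) (Suc r)"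
        "F \<in> carrier_mat (Suc r) (Suc r)" "C' \<in> carrier_mat (Suc r) (Suc r)"
      unfolding X_def L'_def F_def C'_def by auto
    have FS: "zmat n $$ (p + l - 1, q - r + k - 1) \<in> carrier (zring n)" if "l < Suc r" "k < Suc r" for l k
      using that pq rq rn by (intro zmat_entry_in_zring) auto
    have ent: "(L' * F * C') $$ (a, b) = (\<Sum>k<Suc r. (\<Sum>l<Suc r. L (e a) l * zmat n $$ (p + l - 1, q - r + k - 1)) * C k (g b))"
      if "a < Suc r" "b < Suc r" for a b
    proof -
      have mult: "(P * Q) $$ (a, b) = (\<Sum>k<Suc r. P $$ (a, k) * Q $$ (k, b))"
        if "P \<in> carrier_mat (Suc r) (Suc r)" "Q \<in> carrier_mat (Suc r) (Suc r)" "a < Suc r" "b < Suc r"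
        for P Q :: "zpoly mat" and a b
        using that by (simp add: scalar_prod_def lessThan_atLeast0 del: sum.lessThan_Suc sum.op_ivl_Suc)
      have "(L' * F * C') $$ (a, b) = (\<Sum>k<Suc r. (L' * F) $$ (a, k) * C' $$ (k, b))"
        using that carr by (intro mult) auto
      also have "\<dots> = (\<Sum>k<Suc r. (\<Sum>l<Suc r. L' $$ (a, l) * F $$ (l, k)) * C' $$ (k, b))"
        by (rule sum.cong[OF refl]) (use that carr in \<open>auto simp: mult simp del: sum.lessThan_Suc index_mult_mat\<close>)
      finally show ?thesis
        using that unfolding L'_def F_def C'_def by (simp del: sum.lessThan_Suc)
    qed
    have "det X - det (L' * F * C') \<in> J"
    proof (rule det_cong_J)
      show "L' * F * C' \<in> carrier_mat (Suc r) (Suc r)" using carr by simp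
      fix a b assume ab: "a < Suc r" "b < Suc r"
      have X: "X $$ (a, b) = zmat n $$ (e a - 1, g b - 1)" using ab unfolding X_def by simp
      then show "X $$ (a, b) \<in> carrier (zring n)"
        using e[OF ab(1)] g[OF ab(2)] pq by (auto intro!: zmat_entry_in_zring)
      show "(L' * F * C') $$ (a, b) \<in> carrier (zring n)"
        unfolding ent[OF ab] using ab e g by (intro S_sum S_mult L(1) C(1) FS) auto
      \<comment> \<open>First column \<open>g b\<close> is replaced by the columns of
        \<open>F\<close>, then row \<open>e a\<close> by the rows of \<open>F\<close>. The row
        reduction applies to the columns \<open>q - r + k\<close> because \<open>r < q\<close> keeps
        them positive.\<close>
      have "X $$ (a, b) - (\<Sum>k<Suc r. zmat n $$ (e a - 1, q - r + k - 1) * C k (g b)) \<in> J"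
        unfolding X using C(2) e g ab by blast
      moreover have "(\<Sum>k<Suc r. zmat n $$ (e a - 1, q - r + k - 1) * C k (g b)) - (L' * F * C') $$ (a, b) \<in> J"
        unfolding ent[OF ab] sum_subtractf[symmetric] left_diff_distrib[symmetric]
      proof (rule J_sum)
        fix k assume k: "k \<in> {..<Suc r}"
        have "C k (g b) * (zmat n $$ (e a - 1, q - r + k - 1)
            - (\<Sum>l<Suc r. L (e a) l * zmat n $$ (p + l - 1, q - r + k - 1))) \<in> J"
          using k ab e g rq by (intro J_mult C(1) L(2)) auto
        then show "(zmat n $$ (e a - 1, q - r + k - 1)
            - (\<Sum>l<Suc r. L (e a) l * zmat n $$ (p + l - 1, q - r + k - 1))) * C k (g b) \<in> J"
          by (simp only: mult.commute)
      qed
      ultimately have "X $$ (a, b) - (\<Sum>k<Suc r. zmat n $$ (e a - 1, q - r + k - 1) * C k (g b))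
          + ((\<Sum>k<Suc r. zmat n $$ (e a - 1, q - r + k - 1) * C k (g b)) - (L' * F * C') $$ (a, b)) \<in> J"
        by (rule J_add)
      then show "X $$ (a, b) - (L' * F * C') $$ (a, b) \<in> J"
        by (simp only: add_diff_eq diff_add_cancel)
    qed (rule carr)
    moreover have "det (L' * F * C') \<in> J"
    proof -
      have "det F = fpoly n w p q"
        unfolding F_def f_eq using minor_interval[of p "q - r" r n] pq rq rn by simp
      moreover have "det (L' * F * C') = det L' * det C' * det F"
        using carr by (simp add: det_mult[of _ "Suc r"] mult_ac)
      moreover have "det L' \<in> carrier (zring n)" "det C' \<in> carrier (zring n)"
        by (rule det_in_S[OF carr(2)], use e in \<open>auto simp: L'_def intro: L(1)\<close>)
          (rule det_in_S[OF carr(4)], use g in \<open>auto simp: C'_def intro: C(1)\<close>)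
      ultimately show ?thesis using fJ by (simp add: J_mult S_mult)
    qed
    ultimately have "(det X - det (L' * F * C')) + det (L' * F * C') \<in> J" by (rule J_add)
    then show ?thesis unfolding eg(3) X_def by simp
  qed
  then show ?thesis
    unfolding rank_ideal_def r_def[symmetric] J_def[symmetric] by (intro genideal_minimal[OF JI]) auto
qed

end
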